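(* Let $p \geq 5$ be a prime and consider the Cayley cubic \[ x^2 + y^2 + z^2 = xyz + 4 \] over $\mathbb{F}_p$. Let $G$ be the group of permutations of the set of solutions $(x,y,z)\in\mathbb{F}_p^3$ generated by the Markoff moves $m_1:(x,y,z)\mapsto(yz-x,y,z)$, $m_2:(x,y,z)\mapsto(x,xz-y,z)$, $m_3:(x,y,z)\mapsto(x,y,xy-z)$ and all permutations of the three coordinates. Write $\varepsilon = (-1)^{(p-1)/2}$, and for each prime $q$ dividing $p^2-1$ let $e_q$ be the exponent of $q$ in $p^2-1$. Let $Q^+$ and $Q^-$ be the (disjoint) sets of odd primes dividing $p+\varepsilon$ and $p-\varepsilon$ respectively, so that \[ p+\varepsilon = 2\prod_{q\in Q^+} q^{e_q}, \qquad p-\varepsilon = 2^{e_2-1}\prod_{q\in Q^-} q^{e_q}. \] Let $D$ be the set of positive divisors $t$ of $p^2-1$ such that $p+1 \mid t$ or $p-1\mid t$. Then there is a bijection $\Phi$ from $D$ to the set of $G$-orbits on the solutions of the Cayley cubic over $\mathbb{F}_p$ such that: for $t=\prod_{q\mid p^2-1} q^{f_q}\in D$ with $t\neq p^2-1$ and $t\neq \frac{p^2-1}{2}$, the orbit $\Phi(t)$ has size \[ \frac{1}{2}\prod_{q\mid p^2-1,\ f_q<e_q} (q^2-1)\, q^{2(e_q-f_q-1)}, \] while for $t = p^2-1$ and $t=\frac{p^2-1}{2}$ the orbit $\Phi(t)$ has twice the size given by this expression. In particular the number of $G$-orbits equals \[ e_2\prod_{q\in Q^-}(e_q+1) + 2\prod_{q\in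 Q^+}(e_q+1) - 2. \]
   Context: Here $\mathbb{F}_p$ is the field with $p$ elements. The orbits are those of the group generated by the three Vieta (Markoff) moves and the coordinate permutations acting on the set of all triples $(x,y,z)\in\mathbb{F}_p^3$ satisfying the equation. Empty products equal $1$. *)

theory Defs
  imports
    "HOL-Algebra.Group_Action"
    "HOL-Algebra.Generated_Groups"
    "HOL-Computational_Algebra.Primes"
    "HOL-Library.Cardinality"
    Complex_Main
begin

definition cayley_solutions :: "('a::field \<times> 'a \<times> 'a) set" where
  "cayley_solutions = {(x, y, z). x\<^sup>2 + y\<^sup>2 + z\<^sup>2 = x * y * z + 4}"

definition markoff_moves :: "('a::field \<times> 'a \<times> 'a \<Rightarrow> 'a \<times> 'a \<times> 'a) set" where
  "markoff_moves =
    {\<lambda>(x, y, z). (y * z - x, y, z),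
     \<lambda>(x, y, z). (x, x * z - y, z),
     \<lambda>(x, y, z). (x, y, x * y - z)}"

definition coordinate_permutations :: "('a \<times> 'a \<times> 'a \<Rightarrow> 'a \<times> 'a \<times> 'a) set" where
  "coordinate_permutations =
    {\<lambda>(x, y, z). (x, y, z), \<lambda>(x, y, z). (x, z, y), \<lambda>(x, y, z). (y, x, z),
     \<lambda>(x, y, z). (y, z, x), \<lambda>(x, y, z). (z, x, y), \<lambda>(x, y, z). (z, y, x)}"

text \<open>Elements of \<^const>\<open>Bij\<close> are extensional, so the generators have to be restricted to the
  solution set.\<close>

definition cayley_generators :: "('a::field \<times> 'a \<times> 'a \<Rightarrow> 'a \<times> 'a \<times> 'a) set" where
  "cayley_generators =
    (\<lambda>m. restrict m cayley_solutions) ` (markoff_moves \<union> coordinate_permutations)"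

definition cayley_group :: "('a::field \<times> 'a \<times> 'a \<Rightarrow> 'a \<times> 'a \<times> 'a) monoid" where
  "cayley_group = (BijGroup cayley_solutions)
     \<lparr>carrier := generate (BijGroup cayley_solutions) cayley_generators\<rparr>"

definition cayley_orbits :: "('a::field \<times> 'a \<times> 'a) set set" where
  "cayley_orbits = orbits cayley_group cayley_solutions (\<lambda>g. g)"

definition eps :: "nat \<Rightarrow> int" where
  "eps p = (-1) ^ ((p - 1) div 2)"

definition expo :: "nat \<Rightarrow> nat \<Rightarrow> nat" where
  "expo p q = multiplicity q (p\<^sup>2 - 1)"

definition Q_plus :: "nat \<Rightarrow> nat set" where
  "Q_plus p = {q. prime q \<and> odd q \<and> int q dvd int p + eps p}"

definition Q_minus :: "nat \<Rightarrow> nat set" where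
  "Q_minus p = {q. prime q \<and> odd q \<and> int q dvd int p - eps p}"

definition D_set :: "nat \<Rightarrow> nat set" where
  "D_set p = {t. t dvd p\<^sup>2 - 1 \<and> (p + 1 dvd t \<or> p - 1 dvd t)}"

definition size_expr :: "nat \<Rightarrow> nat \<Rightarrow> real" where
  "size_expr p t =
    1 / 2 * (\<Prod>q | prime q \<and> q dvd p\<^sup>2 - 1 \<and> multiplicity q t < expo p q.
               ((real q)\<^sup>2 - 1) * real q ^ (2 * (expo p q - multiplicity q t - 1)))"

lemma cayley_generators_subset_Bij:
  "cayley_generators \<subseteq> Bij (cayley_solutions :: ('a::field \<times> 'a \<times> 'a) set)"
proof -
  let ?S = "cayley_solutions :: ('a \<times> 'a \<times> 'a) set"
  have *: "restrict f ?S \<in> Bij ?S"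
    if "\<And>s. s \<in> ?S \<Longrightarrow> f s \<in> ?S" "\<And>s. s \<in> ?S \<Longrightarrow> g s \<in> ?S"
       "\<And>s. g (f s) = s" "\<And>s. f (g s) = s" for f g
  proof -
    have "bij_betw f ?S ?S"
      by (rule bij_betw_byWitness[where f' = g]) (use that in auto)
    then show ?thesis by (simp add: Bij_def)
  qed
  have "restrict m ?S \<in> Bij ?S" if "m \<in> markoff_moves" for m
    by (rule *[where g = m]; use that in
        \<open>auto simp: markoff_moves_def cayley_solutions_def algebra_simps power2_eq_square\<close>)
  moreover have "restrict m ?S \<in> Bij ?S" if m: "m \<in> coordinate_permutations" for m
  proof -
    obtain g where g: "g \<in> coordinate_permutations" "\<And>s. g (m s) = s" "\<And>s. m (g s) = s"
    proof -
      from m have "m = (\<lambda>(x, y, z). (y, z, x)) \<or> m = (\<lambda>(x, y, z). (z, x, y)) \<or> (\<forall>s. m (m s) = s)"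
        unfolding coordinate_permutations_def by auto
      then show ?thesis
      proof (elim disjE)
        assume "m = (\<lambda>(x, y, z). (y, z, x))"
        then show ?thesis
          by (intro that[of "\<lambda>(x, y, z). (z, x, y)"]) (auto simp: coordinate_permutations_def)
      next
        assume "m = (\<lambda>(x, y, z). (z, x, y))"
        then show ?thesis
          by (intro that[of "\<lambda>(x, y, z). (y, z, x)"]) (auto simp: coordinate_permutations_def)
      next
        assume "\<forall>s. m (m s) = s"
        then show ?thesis using m by (intro that[of m]) auto
      qed
    qed
    have "f s \<in> ?S" if "f \<in> coordinate_permutations" "s \<in> ?S" for f s
      using that by (auto simp: coordinate_permutations_def cayley_solutions_def algebra_simps)
    then show ?thesis using g m by (intro *[where g = g]) auto
  qed
  ultimately show ?thesis by (auto simp: cayley_generators_def)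
qed

end

theory Submission
  imports Defs "HOL-Algebra.Algebraic_Closure_Type" "HOL-Algebra.Sylow" "HOL-Number_Theory.Residues"
begin

text \<open>
  Over the algebraic closure the cubic is parametrised by \<open>(u + 1/u, v + 1/v, uv + 1/(uv))\<close>,
  uniquely up to \<open>(u, v) \<mapsto> (1/u, 1/v)\<close>. Over a finite field of \<open>q\<close> elements the triple is
  rational iff \<open>u\<close> and \<open>v\<close> both lie in the \<open>(q - 1)\<close>-th or both in the \<open>(q + 1)\<close>-th roots of unity.
  Writing \<open>u = g\<^sup>a\<close>, \<open>v = g\<^sup>b\<close> for a primitive \<open>(q\<^sup>2 - 1)\<close>-th root of unity \<open>g\<close>, Markoff moves and
  permutations generate the action of \<open>GL\<^sub>2(\<int>)\<close> on the exponents \<open>(a, b)\<close> modulo \<open>q\<^sup>2 - 1\<close>. By the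
  Euclidean algorithm the orbit of \<open>(a, b)\<close> is that of \<open>(t, 0)\<close> with \<open>t = gcd(a, b, q\<^sup>2 - 1)\<close>,
  which is also an invariant. The orbit of index \<open>t\<close> has \<open>J\<^sub>2((q\<^sup>2 - 1)/t)\<close> exponent pairs, and
  negation identifies them in twos unless \<open>(q\<^sup>2 - 1)/t\<close> is 1 or 2.
\<close>

(* HOL-Algebra's prime would otherwise shadow the number-theoretic one. *)
hide_const (open) Divisibility.prime

subsection \<open>Divisors and Jordan's totient\<close>

lemma gcd_gcd_distrib: "gcd (gcd a b) c = gcd (gcd a c) (gcd b c)"
  for a b c :: "'a :: semiring_gcd"
  by (simp add: ac_simps)

lemma gcd_gcd_mod: "gcd (gcd (a mod n) (b mod n)) n = gcd (gcd a b) n"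
  for a b n :: "'a :: euclidean_semiring_gcd"
  by (cases "n = 0") (simp_all add: gcd_gcd_distrib[of _ _ n])

lemma prod_prime_factors_superset:
  fixes d n :: nat
  assumes "d dvd n" "n > 0"
  shows "(\<Prod>q\<in>prime_factors n. q ^ multiplicity q d) = d"
proof -
  have "d > 0" "prime_factors d \<subseteq> prime_factors n"
    using assms dvd_prime_factors[of n d] by (auto intro: dvd_pos_nat)
  then have "(\<Prod>q\<in>prime_factors n. q ^ multiplicity q d) =
      (\<Prod>q\<in>prime_factors d. q ^ multiplicity q d)"
    by (intro prod.mono_neutral_right)
       (auto simp: in_prime_factors_iff not_dvd_imp_multiplicity_0)
  then show ?thesis using \<open>d > 0\<close> by (simp add: prod_prime_factors)
qed

lemma card_divisors_nat:
  fixes n :: nat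
  assumes "n > 0"
  shows "card {d. d dvd n} = (\<Prod>q\<in>prime_factors n. multiplicity q n + 1)"
proof -
  let ?P = "prime_factors n"
  let ?E = "\<Pi>\<^sub>E q\<in>?P. {..multiplicity q n}"
  have multiplicity_prod: "multiplicity q (\<Prod>q\<in>?P. q ^ f q) = (if q \<in> ?P then f q else 0)"
    if "prime q" for q f
    using that by (intro multiplicity_prod_prime_powers) auto
  have "bij_betw (\<lambda>f. \<Prod>q\<in>?P. q ^ f q) ?E {d. d dvd n}"
  proof (rule bij_betw_byWitness[where f' = "\<lambda>d. restrict (\<lambda>q. multiplicity q d) ?P"])
    show "\<forall>f\<in>?E. restrict (\<lambda>q. multiplicity q (\<Prod>q\<in>?P. q ^ f q)) ?P = f"
    proof (intro ballI ext)
      fix f q assume "f \<in> ?E"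
      then show "restrict (\<lambda>q. multiplicity q (\<Prod>q\<in>?P. q ^ f q)) ?P q = f q"
        by (cases "q \<in> ?P")
           (simp_all add: multiplicity_prod in_prime_factors_imp_prime PiE_arb[of f])
    qed
    show "\<forall>d\<in>{d. d dvd n}. (\<Prod>q\<in>?P. q ^ restrict (\<lambda>q. multiplicity q d) ?P q) = d"
      using assms by (simp add: prod_prime_factors_superset cong: prod.cong)
    show "(\<lambda>f. \<Prod>q\<in>?P. q ^ f q) ` ?E \<subseteq> {d. d dvd n}"
    proof clarify
      fix f assume "f \<in> ?E"
      then have "(\<Prod>q\<in>?P. q ^ f q) dvd (\<Prod>q\<in>?P. q ^ multiplicity q n)"
        by (intro prod_dvd_prod le_imp_power_dvd) auto
      then show "(\<Prod>q\<in>?P. q ^ f q) dvd n" using assms by (simp add: prod_prime_factors)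
    qed
    show "(\<lambda>d. restrict (\<lambda>q. multiplicity q d) ?P) ` {d. d dvd n} \<subseteq> ?E"
      using assms by (auto intro!: dvd_imp_multiplicity_le)
  qed
  then show ?thesis by (simp add: bij_betw_same_card[symmetric] card_PiE)
qed

lemma dvd_double_iff:
  fixes n t :: nat
  assumes "even n" "n > 0" "t dvd n"
  shows "n dvd 2 * t \<longleftrightarrow> t = n \<or> t = n div 2"
proof -
  obtain d where n_eq: "n = t * d" using assms(3) by (elim dvdE)
  have pos: "t > 0" "d > 0" using assms(2) by (simp_all add: n_eq)
  then have "n dvd 2 * t \<longleftrightarrow> d dvd 2" unfolding n_eq by (simp add: mult.commute[of 2])
  also have "\<dots> \<longleftrightarrow> d = 1 \<or> d = 2"
    using pos two_is_prime_nat by (auto simp: prime_nat_iff)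
  also have "\<dots> \<longleftrightarrow> t = n \<or> t = n div 2"
    using pos assms(1) unfolding n_eq by auto
  finally show ?thesis .
qed

lemma prod_prime_factors_even:
  fixes n :: nat and f :: "nat \<Rightarrow> 'a :: comm_monoid_mult"
  assumes "even n" "n > 0"
  shows "(\<Prod>q\<in>prime_factors n. f q) = f 2 * (\<Prod>q | prime q \<and> odd q \<and> q dvd n. f q)"
proof -
  have "prime_factors n = insert 2 {q. prime q \<and> odd q \<and> q dvd n}"
    using assms primes_dvd_imp_eq[of "2 :: nat"] by (auto simp: in_prime_factors_iff)
  moreover from this have "finite {q. prime q \<and> odd q \<and> q dvd n}"
    by (metis finite_insert finite_set_mset)
  ultimately show ?thesis by simp
qed

lemma card_multiples_dvd:
  fixes c n :: nat
  assumes "c > 0"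
  shows "card {t. t dvd c * n \<and> c dvd t} = card {d. d dvd n}"
proof -
  have "{t. t dvd c * n \<and> c dvd t} = (*) c ` {d. d dvd n}"
    using assms by (auto elim!: dvdE)
  then show ?thesis using assms by (simp add: card_image inj_on_def)
qed

lemma card_dvd_mult_multiples:
  fixes a b :: nat
  assumes "a > 0" "b > 0"
  shows "card {t. t dvd a * b \<and> (a dvd t \<or> b dvd t)} + card {d. d dvd gcd a b} =
    card {d. d dvd a} + card {d. d dvd b}"
proof -
  let ?M = "\<lambda>c. {t. t dvd a * b \<and> c dvd t}"
  have "finite (?M c)" for c using assms by simp
  then have "card (?M a \<union> ?M b) + card (?M a \<inter> ?M b) = card (?M a) + card (?M b)"
    by (intro card_Un_Int[symmetric])
  moreover have "?M a \<union> ?M b = {t. t dvd a * b \<and> (a dvd t \<or> b dvd t)}" by blast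
  moreover have "?M a \<inter> ?M b = {t. t dvd lcm a b * gcd a b \<and> lcm a b dvd t}"
    unfolding lcm_least_iff by (auto simp: mult.commute[of "lcm a b"] simp flip: prod_gcd_lcm_nat)
  ultimately show ?thesis
    using card_multiples_dvd[of a b] card_multiples_dvd[of b a]
      card_multiples_dvd[of "lcm a b" "gcd a b"] assms
    by (simp add: mult.commute lcm_pos_nat)
qed

definition jordan_totient_2 :: "nat \<Rightarrow> nat" where
  "jordan_totient_2 n = (\<Prod>q\<in>prime_factors n. (q\<^sup>2 - 1) * q ^ (2 * (multiplicity q n - 1)))"

lemma jordan_totient_2_prime_mult:
  assumes "prime q" "n > 0"
  shows "jordan_totient_2 (q * n) = (if q dvd n then q\<^sup>2 else q\<^sup>2 - 1) * jordan_totient_2 n"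
proof -
  define J where "J m r = (r\<^sup>2 - 1) * r ^ (2 * (multiplicity r m - 1))" for m r :: nat
  have multiplicity_q: "multiplicity q (q * n) = Suc (multiplicity q n)"
    using assms by (intro multiplicity_times_same) auto
  have J_other: "J (q * n) r = J n r" if "r \<in> prime_factors n - {q}" for r
    using that assms prime_elem_multiplicity_mult_distrib[of r q n]
    by (simp add: J_def in_prime_factors_iff prime_multiplicity_other)
  have "jordan_totient_2 (q * n) = (\<Prod>r\<in>insert q (prime_factors n - {q}). J (q * n) r)"
    using assms
    by (simp add: jordan_totient_2_def J_def prime_factors_product prime_prime_factors
        insert_absorb)
  also have "\<dots> = J (q * n) q * (\<Prod>r\<in>prime_factors n - {q}. J n r)"
    by (subst prod.insert) (use J_other in auto)
  also have "\<dots> = (if q dvd n then q\<^sup>2 else q\<^sup>2 - 1) * (\<Prod>r\<in>prime_factors n. J n r)"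
  proof (cases "q dvd n")
    case True
    then have "q \<in> prime_factors n" "multiplicity q n > 0"
      using assms by (auto simp: in_prime_factors_iff prime_multiplicity_gt_zero_iff)
    then obtain k where "multiplicity q n = Suc k" by (auto simp: gr0_conv_Suc)
    then have "J (q * n) q = q\<^sup>2 * J n q" by (simp add: J_def multiplicity_q power2_eq_square)
    then show ?thesis using True \<open>q \<in> prime_factors n\<close> by (simp add: prod.remove[of _ q])
  next
    case False
    then show ?thesis
      by (simp add: J_def multiplicity_q in_prime_factors_iff not_dvd_imp_multiplicity_0)
  qed
  finally show ?thesis by (simp add: jordan_totient_2_def J_def)
qed

definition gcd_pairs_below :: "nat \<Rightarrow> nat \<Rightarrow> nat \<Rightarrow> (nat \<times> nat) set" where
  "gcd_pairs_below m n t = {(a, b). a < m \<and> b < m \<and> gcd (gcd a b) n = t}"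

abbreviation gcd_pairs :: "nat \<Rightarrow> nat \<Rightarrow> (nat \<times> nat) set" where
  "gcd_pairs n \<equiv> gcd_pairs_below n n"

lemma gcd_pairs_below_iff:
  "(a, b) \<in> gcd_pairs_below m n t \<longleftrightarrow> a < m \<and> b < m \<and> gcd (gcd a b) n = t"
  by (simp add: gcd_pairs_below_def)

lemma finite_gcd_pairs_below [simp]: "finite (gcd_pairs_below m n t)"
  by (rule finite_subset[of _ "{..<m} \<times> {..<m}"]) (auto simp: gcd_pairs_below_def)

lemma card_gcd_pairs_mult:
  assumes "k > 0"
  shows "card (gcd_pairs (k * n) (k * t)) = card (gcd_pairs n t)"
proof -
  have gcd_scale: "gcd (gcd (k * a) (k * b)) (k * n) = k * gcd (gcd a b) n" for a b
    by (simp add: gcd_mult_distrib_nat)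
  have "gcd_pairs (k * n) (k * t) = (\<lambda>(a, b). (k * a, k * b)) ` gcd_pairs n t"
  proof (intro equalityI subrelI)
    fix a b assume ab: "(a, b) \<in> gcd_pairs (k * n) (k * t)"
    then have "k dvd a" "k dvd b"
      unfolding gcd_pairs_below_iff by (metis dvd_trans dvd_triv_left gcd_dvd1 gcd_dvd2)+
    then obtain a' b' where scaled: "a = k * a'" "b = k * b'" by (auto elim!: dvdE)
    then have "(a', b') \<in> gcd_pairs n t"
      using ab assms by (simp add: gcd_pairs_below_iff gcd_scale)
    then show "(a, b) \<in> (\<lambda>(a, b). (k * a, k * b)) ` gcd_pairs n t" using scaled by force
  qed (use assms in \<open>auto simp: gcd_pairs_below_iff gcd_scale\<close>)
  moreover have "inj_on (\<lambda>(a, b). (k * a, k * b)) (gcd_pairs n t)"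
    using assms by (auto simp: inj_on_def)
  ultimately show ?thesis by (simp add: card_image)
qed

lemma card_gcd_pairs_below_mult:
  assumes "n > 0"
  shows "card (gcd_pairs_below (k * n) n t) = k\<^sup>2 * card (gcd_pairs n t)"
proof -
  have block_less: "i * n + a < k * n" if "i < k" "a < n" for i a
    using that mult_le_mono1[of "Suc i" k n] by simp
  have "gcd (gcd (i * n + a) (j * n + b)) n = gcd (gcd a b) n" for i j a b
    by (metis gcd_gcd_mod mod_mult_self3)
  then have "bij_betw (\<lambda>((i, j), (a, b)). (i * n + a, j * n + b))
      (({..<k} \<times> {..<k}) \<times> gcd_pairs n t) (gcd_pairs_below (k * n) n t)"
    using assms
    by (intro bij_betw_byWitness[where f' = "\<lambda>(a, b). ((a div n, b div n), (a mod n, b mod n))"])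
       (auto simp: gcd_pairs_below_iff less_mult_imp_div_less gcd_gcd_mod block_less)
  from bij_betw_same_card[OF this] show ?thesis
    by (simp add: card_cartesian_product power2_eq_square)
qed

lemma gcd_pairs_below_eq_gcd_pairs_if_dvd:
  assumes "k dvd n"
  shows "gcd_pairs_below (k * n) n 1 = gcd_pairs (k * n) 1"
proof -
  have "coprime x (k * n) \<longleftrightarrow> coprime x n" for x
    using coprime_divisors[OF dvd_refl assms] by auto
  then show ?thesis unfolding gcd_pairs_below_def coprime_iff_gcd_eq_1 by simp
qed

lemma gcd_pairs_below_eq_gcd_pairs_if_not_dvd:
  assumes "prime q" "\<not> q dvd n"
  shows "gcd_pairs_below (q * n) n 1 = gcd_pairs (q * n) 1 \<union> gcd_pairs (q * n) q"
proof -
  have "coprime q n" using assms by (rule prime_imp_coprime)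
  have "gcd x n = 1 \<longleftrightarrow> gcd x (q * n) = 1 \<or> gcd x (q * n) = q" for x
  proof
    assume "gcd x n = 1"
    then have "gcd x (q * n) dvd q"
      by (metis coprime_iff_gcd_eq_1 gcd_mult_right_right_cancel gcd_dvd2)
    then show "gcd x (q * n) = 1 \<or> gcd x (q * n) = q"
      using assms(1) by (auto simp: prime_nat_iff)
  next
    assume "gcd x (q * n) = 1 \<or> gcd x (q * n) = q"
    then have "gcd x n dvd q" by (metis dvd_mult dvd_refl gcd_mono one_dvd dvd_trans)
    then show "gcd x n = 1"
      using \<open>coprime q n\<close> by (metis coprime_common_divisor_nat gcd_dvd2)
  qed
  then show ?thesis by (auto simp: gcd_pairs_below_def)
qed

lemma card_gcd_pairs_1:
  assumes "n > 0"
  shows "card (gcd_pairs n 1) = jordan_totient_2 n"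
  using assms
proof (induction n rule: prime_divisors_induct)
  case (unit n)
  then have "gcd_pairs n 1 = {(0, 0)}" by (auto simp: gcd_pairs_below_iff)
  then show ?case using unit by (simp add: jordan_totient_2_def)
next
  case (factor q n)
  then have "n > 0" "q > 0" and IH: "card (gcd_pairs n 1) = jordan_totient_2 n" by simp_all
  note card_below = card_gcd_pairs_below_mult[OF \<open>n > 0\<close>, of q 1]
  show ?case
  proof (cases "q dvd n")
    case True
    have "card (gcd_pairs (q * n) 1) = q\<^sup>2 * card (gcd_pairs n 1)"
      using card_below unfolding gcd_pairs_below_eq_gcd_pairs_if_dvd[OF True] .
    then show ?thesis
      using True factor.hyps \<open>n > 0\<close> IH by (simp add: jordan_totient_2_prime_mult)
  next
    case False
    have "gcd_pairs (q * n) 1 \<inter> gcd_pairs (q * n) q = {}"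
      using prime_gt_1_nat[OF factor.hyps] by (auto simp: gcd_pairs_below_def)
    then have "q\<^sup>2 * card (gcd_pairs n 1) = card (gcd_pairs (q * n) 1) + card (gcd_pairs (q * n) q)"
      using card_below gcd_pairs_below_eq_gcd_pairs_if_not_dvd[OF factor.hyps False]
      by (simp add: card_Un_disjoint)
    then have "card (gcd_pairs (q * n) 1) = (q\<^sup>2 - 1) * card (gcd_pairs n 1)"
      using card_gcd_pairs_mult[OF \<open>q > 0\<close>, of n 1] by (simp add: diff_mult_distrib)
    then show ?thesis
      using False factor.hyps \<open>n > 0\<close> IH by (simp add: jordan_totient_2_prime_mult)
  qed
qed simp

corollary card_gcd_pairs:
  assumes "t dvd n" "n > 0"
  shows "card (gcd_pairs n t) = jordan_totient_2 (n div t)"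
proof -
  obtain d where "n = t * d" using assms(1) by (elim dvdE)
  then show ?thesis
    using assms(2) card_gcd_pairs_mult[of t d 1] card_gcd_pairs_1[of d] by simp
qed

lemma dvd_add_iff_eq_diff_mod:
  fixes a b n :: nat
  assumes "a < n" "b < n"
  shows "n dvd b + a \<longleftrightarrow> b = (n - a) mod n"
proof (cases "a = 0")
  case True
  then show ?thesis using assms by (auto dest: dvd_imp_le)
next
  case False
  have "n dvd b + a \<longleftrightarrow> b + a = n"
  proof
    assume "n dvd b + a"
    then obtain k where b_plus_a: "b + a = n * k" by (elim dvdE)
    then have "n * k < n * 2" "n * k > 0" using assms False by linarith+
    then have "k = 1" by simp
    then show "b + a = n" using b_plus_a by simp
  qed simp
  then show ?thesis using False assms by auto
qed

lemma diff_mod_in_gcd_pairs: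
  assumes "(a, b) \<in> gcd_pairs n t"
  shows "((n - a) mod n, (n - b) mod n) \<in> gcd_pairs n t"
proof -
  have "gcd (n - x) n = gcd x n" if "x < n" for x
    using that by (metis gcd.commute gcd_diff1_nat gcd_diff2_nat less_imp_le)
  then have "gcd (gcd (n - a) (n - b)) n = gcd (gcd a b) n"
    using assms by (simp add: gcd_pairs_below_iff gcd_gcd_distrib[of _ _ n])
  then show ?thesis using assms by (simp add: gcd_pairs_below_iff gcd_gcd_mod)
qed

lemma dvd_mult_gcd_pairs_iff:
  assumes "(a, b) \<in> gcd_pairs n t"
  shows "n dvd k * a \<and> n dvd k * b \<longleftrightarrow> n dvd k * t"
proof -
  have "n dvd k * a \<and> n dvd k * b \<longleftrightarrow> n dvd gcd (gcd (k * a) (k * b)) (k * n)" by simp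
  also have "gcd (gcd (k * a) (k * b)) (k * n) = k * t"
    using assms by (simp add: gcd_pairs_below_iff flip: gcd_mult_distrib_nat)
  finally show ?thesis .
qed

lemma card_fibres:
  assumes "finite A" "\<And>x. x \<in> A \<Longrightarrow> card {y \<in> A. f y = f x} = k"
  shows "card A = k * card (f ` A)"
proof -
  have "card A = (\<Sum>z\<in>f ` A. \<Sum>y | y \<in> A \<and> f y = z. 1)"
    using sum.image_gen[OF assms(1), of "\<lambda>_. 1 :: nat" f] by simp
  also have "\<dots> = (\<Sum>z\<in>f ` A. k)" using assms(2) by (intro sum.cong) auto
  finally show ?thesis by (simp add: mult.commute)
qed

subsection \<open>The numbers \<open>p + \<epsilon>\<close> and \<open>p - \<epsilon>\<close>\<close>

definition plus_eps :: "nat \<Rightarrow> nat" where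
  "plus_eps p = nat (int p + eps p)"

definition minus_eps :: "nat \<Rightarrow> nat" where
  "minus_eps p = nat (int p - eps p)"

lemma square_minus_1_nat: "n\<^sup>2 - 1 = (n + 1) * (n - 1)" for n :: nat
  by (simp add: power2_eq_square algebra_simps)

context
  fixes p :: nat
  assumes p_odd: "odd p" and p_ge_3: "p \<ge> 3"
begin

lemma plus_minus_eps_cases:
  obtains k where "k > 0" "p = 4 * k + 1" "eps p = 1" "plus_eps p = 4 * k + 2" "minus_eps p = 4 * k"
  | k where "p = 4 * k + 3" "eps p = - 1" "plus_eps p = 4 * k + 2" "minus_eps p = 4 * k + 4"
proof -
  have "p mod 4 = 1 \<or> p mod 4 = 3" using p_odd by presburger
  then consider (one) k where "p = 4 * k + 1" | (three) k where "p = 4 * k + 3"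
    by (metis mult_div_mod_eq)
  then show thesis
  proof cases
    case one
    then have "eps p = 1" by (simp add: eps_def)
    then show thesis
      using one p_ge_3 that(1)[of k]
      by (simp add: plus_eps_def minus_eps_def nat_add_distrib nat_mult_distrib)
  next
    case three
    then have "eps p = - 1" by (simp add: eps_def)
    then show thesis
      using three that(2)[of k]
      by (simp add: plus_eps_def minus_eps_def nat_add_distrib nat_mult_distrib)
  qed
qed

lemma int_plus_eps: "int (plus_eps p) = int p + eps p"
  and int_minus_eps: "int (minus_eps p) = int p - eps p"
  and plus_eps_pos: "plus_eps p > 0"
  and minus_eps_pos: "minus_eps p > 0"
  and even_plus_eps: "even (plus_eps p)"
  and even_minus_eps: "even (minus_eps p)"
  and plus_eps_mult_minus_eps: "plus_eps p * minus_eps p = p\<^sup>2 - 1"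
  by (cases rule: plus_minus_eps_cases; simp add: power2_eq_square algebra_simps)+

lemma multiplicity_2_plus_eps: "multiplicity 2 (plus_eps p) = 1"
proof (rule multiplicity_eqI)
  show "2 ^ 1 dvd plus_eps p" using even_plus_eps by simp
  show "\<not> 2 ^ Suc 1 dvd plus_eps p" by (cases rule: plus_minus_eps_cases) (simp; presburger)+
qed

lemma expo_eq_add:
  "prime q \<Longrightarrow> expo p q = multiplicity q (plus_eps p) + multiplicity q (minus_eps p)"
  unfolding expo_def plus_eps_mult_minus_eps[symmetric]
  using plus_eps_pos minus_eps_pos by (simp add: prime_elem_multiplicity_mult_distrib)

lemma expo_2: "expo p 2 = multiplicity 2 (minus_eps p) + 1"
  by (simp add: expo_eq_add multiplicity_2_plus_eps)

lemma gcd_plus_minus_eps: "gcd (plus_eps p) (minus_eps p) = 2"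
proof (rule gcd_unique_nat[THEN iffD1, symmetric], intro conjI allI impI)
  fix d assume "d dvd plus_eps p \<and> d dvd minus_eps p"
  moreover have "plus_eps p = minus_eps p + 2 \<or> minus_eps p = plus_eps p + 2"
    by (cases rule: plus_minus_eps_cases) simp_all
  ultimately show "d dvd 2" by (metis dvd_add_right_iff)
qed (use even_plus_eps even_minus_eps in auto)

lemma D_set_eq:
  "D_set p = {t. t dvd plus_eps p * minus_eps p \<and> (plus_eps p dvd t \<or> minus_eps p dvd t)}"
proof -
  have "p + 1 dvd t \<or> p - 1 dvd t \<longleftrightarrow> plus_eps p dvd t \<or> minus_eps p dvd t" for t
    by (cases rule: plus_minus_eps_cases) (auto simp: add.commute)
  then show ?thesis unfolding D_set_def plus_eps_mult_minus_eps by simp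
qed

lemma Q_plus_eq: "Q_plus p = {q. prime q \<and> odd q \<and> q dvd plus_eps p}"
  unfolding Q_plus_def int_plus_eps[symmetric] by simp

lemma Q_minus_eq: "Q_minus p = {q. prime q \<and> odd q \<and> q dvd minus_eps p}"
  unfolding Q_minus_def int_minus_eps[symmetric] by simp

lemma Q_plus_Int_Q_minus: "Q_plus p \<inter> Q_minus p = {}"
proof -
  have False if "prime q" "odd q" "q dvd plus_eps p" "q dvd minus_eps p" for q
  proof -
    have "q dvd 2" using gcd_greatest[OF that(3,4)] by (simp add: gcd_plus_minus_eps)
    then have "q = 2" using \<open>prime q\<close> by (simp add: primes_dvd_imp_eq)
    then show False using \<open>odd q\<close> by simp
  qed
  then show ?thesis unfolding Q_plus_eq Q_minus_eq by blast
qed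

lemma expo_eq_multiplicity:
  assumes "prime q" "odd q"
  shows "q dvd plus_eps p \<Longrightarrow> expo p q = multiplicity q (plus_eps p)"
    and "q dvd minus_eps p \<Longrightarrow> expo p q = multiplicity q (minus_eps p)"
proof -
  have "\<not> q dvd plus_eps p \<or> \<not> q dvd minus_eps p"
    using Q_plus_Int_Q_minus assms by (auto simp: Q_plus_eq Q_minus_eq)
  then show "q dvd plus_eps p \<Longrightarrow> expo p q = multiplicity q (plus_eps p)"
    and "q dvd minus_eps p \<Longrightarrow> expo p q = multiplicity q (minus_eps p)"
    using assms(1) by (auto simp: expo_eq_add not_dvd_imp_multiplicity_0)
qed

lemma prod_prime_factors_plus_eps:
  fixes f :: "nat \<Rightarrow> nat \<Rightarrow> 'b :: comm_monoid_mult"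
  shows "(\<Prod>q\<in>prime_factors (plus_eps p). f q (multiplicity q (plus_eps p))) =
    f 2 1 * (\<Prod>q\<in>Q_plus p. f q (expo p q))"
  using even_plus_eps plus_eps_pos
  by (simp add: prod_prime_factors_even multiplicity_2_plus_eps Q_plus_eq expo_eq_multiplicity)

lemma prod_prime_factors_minus_eps:
  fixes f :: "nat \<Rightarrow> nat \<Rightarrow> 'b :: comm_monoid_mult"
  shows "(\<Prod>q\<in>prime_factors (minus_eps p). f q (multiplicity q (minus_eps p))) =
    f 2 (expo p 2 - 1) * (\<Prod>q\<in>Q_minus p. f q (expo p q))"
  using even_minus_eps minus_eps_pos
  by (simp add: prod_prime_factors_even expo_2 Q_minus_eq expo_eq_multiplicity)

lemma plus_eps_eq_prod: "int p + eps p = 2 * (\<Prod>q\<in>Q_plus p. int q ^ expo p q)"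
  using prod_prime_factors_plus_eps[of "\<lambda>q k. q ^ k"] plus_eps_pos
  by (simp add: prod_prime_factors flip: int_plus_eps)

lemma minus_eps_eq_prod: "int p - eps p = 2 ^ (expo p 2 - 1) * (\<Prod>q\<in>Q_minus p. int q ^ expo p q)"
  using prod_prime_factors_minus_eps[of "\<lambda>q k. q ^ k"] minus_eps_pos
  by (simp add: prod_prime_factors flip: int_minus_eps)

lemma card_D_set:
  "int (card (D_set p)) =
    int (expo p 2) * (\<Prod>q\<in>Q_minus p. int (expo p q) + 1)
    + 2 * (\<Prod>q\<in>Q_plus p. int (expo p q) + 1) - 2"
proof -
  have "card {d. d dvd plus_eps p} = 2 * (\<Prod>q\<in>Q_plus p. expo p q + 1)"
    using prod_prime_factors_plus_eps[of "\<lambda>q k. k + 1"] plus_eps_pos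
    by (simp add: card_divisors_nat)
  moreover have "card {d. d dvd minus_eps p} = expo p 2 * (\<Prod>q\<in>Q_minus p. expo p q + 1)"
    using prod_prime_factors_minus_eps[of "\<lambda>q k. k + 1"] minus_eps_pos
    by (simp add: card_divisors_nat expo_2)
  moreover have "card {d. d dvd (2 :: nat)} = 2"
    by (simp add: card_divisors_nat prime_factorization_prime)
  ultimately have "card (D_set p) + 2 =
      2 * (\<Prod>q\<in>Q_plus p. expo p q + 1) + expo p 2 * (\<Prod>q\<in>Q_minus p. expo p q + 1)"
    using card_dvd_mult_multiples[OF plus_eps_pos minus_eps_pos]
    by (simp only: D_set_eq gcd_plus_minus_eps)
  then have "int (card (D_set p) + 2) =
      int (2 * (\<Prod>q\<in>Q_plus p. expo p q + 1) + expo p 2 * (\<Prod>q\<in>Q_minus p. expo p q + 1))"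
    by (rule arg_cong)
  then show ?thesis by (simp add: add.commute)
qed

end

lemma size_expr_eq_jordan_totient_2:
  assumes "t dvd p\<^sup>2 - 1" "p > 1"
  shows "size_expr p t = real (jordan_totient_2 ((p\<^sup>2 - 1) div t)) / 2"
proof -
  obtain d where square_eq: "p\<^sup>2 - 1 = t * d" using assms(1) by (elim dvdE)
  have "t * d > 0" using one_less_power[OF assms(2), of 2] by (simp flip: square_eq)
  then have "t > 0" "d > 0" by simp_all
  have expo: "expo p q = multiplicity q t + multiplicity q d" if "prime q" for q
    unfolding expo_def square_eq using that \<open>t > 0\<close> \<open>d > 0\<close>
    by (simp add: prime_elem_multiplicity_mult_distrib)
  have "{q. prime q \<and> q dvd p\<^sup>2 - 1 \<and> multiplicity q t < expo p q} = prime_factors d"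
    unfolding square_eq using \<open>d > 0\<close>
    by (auto simp: expo in_prime_factors_iff prime_multiplicity_gt_zero_iff)
  moreover have "((real q)\<^sup>2 - 1) * real q ^ (2 * (expo p q - multiplicity q t - 1)) =
      real ((q\<^sup>2 - 1) * q ^ (2 * (multiplicity q d - 1)))" if "q \<in> prime_factors d" for q
  proof -
    have "prime q" using that by (rule in_prime_factors_imp_prime)
    then have "q\<^sup>2 \<ge> 1" using prime_gt_0_nat[of q] by simp
    then show ?thesis using \<open>prime q\<close> by (simp add: expo of_nat_diff)
  qed
  ultimately show ?thesis
    using \<open>t > 0\<close> unfolding size_expr_def jordan_totient_2_def square_eq by simp
qed

lemma square_minus_1_in_D_set:
  assumes "odd p"
  shows "p\<^sup>2 - 1 \<in> D_set p" "(p\<^sup>2 - 1) div 2 \<in> D_set p"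
proof -
  define m where "m = p + 1"
  obtain k where "p - 1 = 2 * k" using assms by (elim oddE) simp
  then have square_eq: "p\<^sup>2 - 1 = 2 * (m * k)"
    unfolding square_minus_1_nat m_def[symmetric] by simp
  show "p\<^sup>2 - 1 \<in> D_set p" "(p\<^sup>2 - 1) div 2 \<in> D_set p"
    unfolding D_set_def square_eq m_def[symmetric] by simp_all
qed

subsection \<open>Roots of unity\<close>

definition primitive_root_of_unity :: "nat \<Rightarrow> 'k :: monoid_mult \<Rightarrow> bool" where
  "primitive_root_of_unity n g \<longleftrightarrow> (\<forall>k. g ^ k = 1 \<longleftrightarrow> n dvd k)"

lemma primitive_root_of_unity_dvd_if_mult_power_eq_1:
  fixes g h :: "'k :: comm_monoid_mult"
  assumes "primitive_root_of_unity m g" "primitive_root_of_unity n h" "coprime m n"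
    and "(g * h) ^ k = 1"
  shows "m dvd k"
proof -
  have "1 = ((g * h) ^ k) ^ n" using assms(4) by simp
  also have "\<dots> = g ^ (n * k) * (h ^ n) ^ k"
    by (simp add: power_mult_distrib mult.commute flip: power_mult)
  also have "h ^ n = 1" using assms(2) by (simp add: primitive_root_of_unity_def)
  finally have "m dvd n * k" using assms(1) by (simp add: primitive_root_of_unity_def)
  then show ?thesis using assms(3) by (simp add: coprime_dvd_mult_right_iff)
qed

lemma primitive_root_of_unity_mult:
  fixes g h :: "'k :: comm_monoid_mult"
  assumes g: "primitive_root_of_unity m g" and h: "primitive_root_of_unity n h" and "coprime m n"
  shows "primitive_root_of_unity (m * n) (g * h)"
  unfolding primitive_root_of_unity_def
proof (intro allI iffI)
  fix k assume gh: "(g * h) ^ k = 1"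
  have "m dvd k"
    using g h assms(3) gh by (rule primitive_root_of_unity_dvd_if_mult_power_eq_1)
  moreover have "n dvd k"
    using primitive_root_of_unity_dvd_if_mult_power_eq_1[OF h g] assms(3) gh by (simp add: ac_simps)
  ultimately show "m * n dvd k" using assms(3) by (simp add: divides_mult)
next
  fix k assume "m * n dvd k"
  then have "m dvd k" "n dvd k" by (auto intro: dvd_mult_left dvd_mult_right)
  then have "g ^ k = 1" "h ^ k = 1" using g h by (simp_all add: primitive_root_of_unity_def)
  then show "(g * h) ^ k = 1" by (simp add: power_mult_distrib)
qed

lemma primitive_root_of_unity_if_power:
  assumes "primitive_root_of_unity n (h ^ k)" "k dvd n" "k > 0"
  shows "primitive_root_of_unity (k * n) h"
  unfolding primitive_root_of_unity_def
proof (intro allI iffI)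
  fix j assume "h ^ j = 1"
  then have "(h ^ k) ^ j = 1" by (metis mult.commute power_mult power_one)
  then have "k dvd j" using assms dvd_trans unfolding primitive_root_of_unity_def by blast
  then obtain i where "j = k * i" by (elim dvdE)
  then show "k * n dvd j"
    using \<open>h ^ j = 1\<close> assms by (simp add: primitive_root_of_unity_def power_mult)
next
  fix j assume "k * n dvd j"
  then obtain i where "j = k * (n * i)" unfolding dvd_def mult.assoc by blast
  moreover have "(h ^ k) ^ (n * i) = 1" using assms(1) unfolding primitive_root_of_unity_def by simp
  ultimately show "h ^ j = 1" by (simp add: power_mult)
qed

lemma ex_primitive_root_of_unity_prime:
  assumes "prime q" "of_nat q \<noteq> (0 :: 'k :: alg_closed_field)"
  shows "\<exists>z :: 'k. primitive_root_of_unity q z"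
proof -
  have "q \<ge> 2" using assms(1) by (rule prime_ge_2_nat)
  then obtain z :: 'k where "(\<Sum>k\<le>q - 1. 1 * z ^ k) = 0"
    using alg_closed[of "q - 1" "\<lambda>_. 1"] by auto
  moreover have "{..q - 1} = {..<q}" using \<open>q \<ge> 2\<close> by auto
  ultimately have sum_eq_0: "(\<Sum>k<q. z ^ k) = 0" by simp
  then have "z \<noteq> 1" using assms(2) by auto
  have "z ^ q = 1" using sum_eq_0 power_diff_1_eq[of z q] by simp
  have "q dvd k" if "z ^ k = 1" for k
  proof (rule ccontr)
    assume "\<not> q dvd k"
    then have "coprime k q" "k \<noteq> 0"
      using prime_imp_coprime[OF assms(1)] coprime_commute by (blast, metis dvd_0_right)
    then obtain x y where "k * x = q * y + 1"
      using bezout_nat[of k q] by auto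
    then have "(z ^ k) ^ x = (z ^ q) ^ y * z" by (simp flip: power_mult power_add)
    then show False using \<open>z ^ k = 1\<close> \<open>z ^ q = 1\<close> \<open>z \<noteq> 1\<close> by simp
  qed
  then have "primitive_root_of_unity q z"
    using \<open>z ^ q = 1\<close> by (auto simp: primitive_root_of_unity_def power_mult elim!: dvdE)
  then show ?thesis ..
qed

lemma ex_primitive_root_of_unity:
  assumes "of_nat n \<noteq> (0 :: 'k :: alg_closed_field)"
  shows "\<exists>g :: 'k. primitive_root_of_unity n g"
  using assms
proof (induction n rule: prime_divisors_induct)
  case (unit n)
  then show ?case by (auto simp: primitive_root_of_unity_def intro!: exI[of _ 1])
next
  case (factor q n)
  then obtain g :: 'k where g: "primitive_root_of_unity n g" by auto
  have "q > 0" using factor.hyps by (rule prime_gt_0_nat)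
  show ?case
  proof (cases "q dvd n")
    case True
    obtain h where "h ^ q = g" using nth_root_exists \<open>q > 0\<close> by blast
    then show ?thesis using primitive_root_of_unity_if_power[of n h q] g True \<open>q > 0\<close> by blast
  next
    case False
    obtain z :: 'k where "primitive_root_of_unity q z"
      using ex_primitive_root_of_unity_prime[OF factor.hyps] factor.prems by auto
    then show ?thesis
      using primitive_root_of_unity_mult[of q z n g] g prime_imp_coprime[OF factor.hyps False]
      by blast
  qed
qed simp

lemma
  fixes f :: "'k :: idom poly"
  assumes "degree f < n"
  shows finite_power_eq_poly: "finite {x. x ^ n = poly f x}"
    and card_power_eq_poly_le: "card {x. x ^ n = poly f x} \<le> n"
proof -
  let ?f = "monom 1 n - f"
  have "coeff ?f n = 1" using assms by (simp add: coeff_eq_0)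
  then have "?f \<noteq> 0" by auto
  moreover have "degree ?f \<le> n"
    using assms by (intro degree_diff_le) (simp_all add: degree_monom_le)
  moreover have "{x. x ^ n = poly f x} = {x. poly ?f x = 0}" by (simp add: poly_monom)
  ultimately show "finite {x. x ^ n = poly f x}" "card {x. x ^ n = poly f x} \<le> n"
    using poly_roots_finite[of ?f] card_poly_roots_bound[of ?f] by simp_all
qed

lemma primitive_root_of_unity_nonzero:
  fixes g :: "'k :: semidom"
  assumes "primitive_root_of_unity n g" "n > 0"
  shows "g \<noteq> 0"
proof -
  have "g ^ n = 1" using assms(1) by (simp add: primitive_root_of_unity_def)
  then show ?thesis using assms(2) by (auto simp: power_0_left)
qed

lemma powers_of_primitive_root_of_unity:
  fixes g :: "'k :: field"
  assumes g: "primitive_root_of_unity n g" and "n > 0"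
  shows "(\<lambda>k. g ^ k) ` {..<n} = {u. u ^ n = 1}"
proof (rule card_seteq)
  have "g \<noteq> 0" using assms by (rule primitive_root_of_unity_nonzero)
  have "inj_on (\<lambda>k. g ^ k) {..<n}"
  proof (rule linorder_inj_onI)
    fix i j assume "i < j" "j \<in> {..<n}"
    then have "\<not> n dvd j - i" by (auto dest: dvd_imp_le)
    then have "g ^ (j - i) \<noteq> 1" using g by (simp add: primitive_root_of_unity_def)
    then show "g ^ i \<noteq> g ^ j" using \<open>i < j\<close> \<open>g \<noteq> 0\<close> by (simp add: power_diff)
  qed auto
  then have "card ((\<lambda>k. g ^ k) ` {..<n}) = n" by (simp add: card_image)
  then show "finite {u :: 'k. u ^ n = 1}" "card {u :: 'k. u ^ n = 1} \<le> card ((\<lambda>k. g ^ k) ` {..<n})"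
    using finite_power_eq_poly[of 1 n] card_power_eq_poly_le[of 1 n] assms(2) by simp_all
  show "(\<lambda>k. g ^ k) ` {..<n} \<subseteq> {u. u ^ n = 1}"
    using g by (auto simp: primitive_root_of_unity_def simp flip: power_mult)
qed

lemma primitive_root_of_unity_powi_eq_1_iff:
  fixes g :: "'k :: field"
  assumes "primitive_root_of_unity n g"
  shows "g powi k = 1 \<longleftrightarrow> int n dvd k"
proof -
  have "g powi k = 1 \<longleftrightarrow> g ^ nat \<bar>k\<bar> = 1"
    by (cases "k \<ge> 0") (simp_all add: power_int_def power_inverse)
  also have "\<dots> \<longleftrightarrow> int n dvd k"
    using assms by (simp add: primitive_root_of_unity_def flip: int_dvd_int_iff)
  finally show ?thesis .
qed

subsection \<open>Finite fields\<close>

lemma prime_dvd_CARD_imp_eq_CHAR: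
  assumes "prime r" "r dvd CARD('a :: {field, finite})"
  shows "r = CHAR('a)"
proof -
  define G where "G = (\<lparr>carrier = UNIV, monoid.mult = (+), one = 0\<rparr> :: 'a monoid)"
  have "\<exists>y. y + x = 0 \<and> x + y = 0" for x :: 'a by (intro exI[of _ "- x"]) simp
  then interpret group G by unfold_locales (auto simp: G_def Units_def add.assoc)
  have nat_pow_eq: "x [^]\<^bsub>G\<^esub> k = of_nat k * x" for x and k :: nat
    by (induction k) (simp_all add: G_def algebra_simps)
  obtain m where "CARD('a) = r ^ 1 * m" using assms(2) by auto
  then obtain H where H: "subgroup H G" "card H = r ^ 1"
    using sylow_thm[OF assms(1), of G 1 m] is_group by (auto simp: Coset.order_def G_def)
  have "0 \<in> H" using subgroup.one_closed[OF H(1)] by (simp add: G_def)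
  moreover have "H \<noteq> {0}" using H(2) prime_gt_1_nat[OF assms(1)] by auto
  ultimately obtain x where x: "x \<in> H" "x \<noteq> 0" by blast
  interpret H: group "G\<lparr>carrier := H\<rparr>"
    using H(1) is_group by (rule subgroup.subgroup_is_group)
  have "of_nat r * x = 0"
    using H.pow_order_eq_1[of x] x(1) H(2) nat_pow_eq[of x r] nat_pow_consistent[of x r H]
    by (simp add: Coset.order_def G_def)
  then have "CHAR('a) dvd r" using x(2) by (simp add: of_nat_eq_0_iff_char_dvd)
  then show ?thesis using assms(1) by (auto simp: prime_nat_iff)
qed

lemma prime_CHAR_finite_field: "prime CHAR('a :: {field, finite})"
  by (intro prime_CHAR_semidom finite_imp_CHAR_pos) simp

lemma CARD_eq_CHAR_power:
  "\<exists>n. CARD('a :: {field, finite}) = CHAR('a) ^ n"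
proof -
  have "prime_factors CARD('a) \<subseteq> {CHAR('a)}"
    using prime_dvd_CARD_imp_eq_CHAR[where 'a = 'a] by (auto simp: in_prime_factors_iff)
  then have "(\<Prod>r\<in>prime_factors CARD('a). r ^ multiplicity r CARD('a)) =
      (\<Prod>r\<in>{CHAR('a)}. r ^ multiplicity r CARD('a))"
    using prime_CHAR_finite_field[where 'a = 'a]
    by (intro prod.mono_neutral_left) (auto simp: in_prime_factors_iff not_dvd_imp_multiplicity_0)
  then have "CARD('a) = CHAR('a) ^ multiplicity CHAR('a) CARD('a)" by (simp add: prod_prime_factors)
  then show ?thesis ..
qed

lemma add_power_CARD:
  fixes x y :: "'a :: {field, finite} alg_closure"
  shows "(x + y) ^ CARD('a) = x ^ CARD('a) + y ^ CARD('a)"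
proof -
  obtain n where "CARD('a) = CHAR('a) ^ n" using CARD_eq_CHAR_power by blast
  then show ?thesis by (intro freshmans_dream') (simp_all add: prime_CHAR_finite_field)
qed

lemma CARD_field_gt_1: "CARD('a :: {field, finite}) > 1"
  using card_mono[of "UNIV :: 'a set" "{0, 1}"] by simp

lemma power_CARD_eq_self:
  fixes x :: "'a :: {field, finite}"
  shows "x ^ CARD('a) = x"
proof (cases "x = 0")
  case False
  then have "bij_betw ((*) x) (- {0}) (- {0})"
    by (intro bij_betw_byWitness[where f' = "\<lambda>y. y / x"]) auto
  then have "\<Prod>(- {0}) = (\<Prod>y\<in>- {0}. x * y)" by (rule prod.reindex_bij_betw[symmetric])
  also have "\<dots> = x ^ card (- {0 :: 'a}) * \<Prod>(- {0})" by (simp add: prod.distrib)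
  finally have "x ^ card (- {0 :: 'a}) = 1" by simp
  moreover have "CARD('a) = Suc (card (- {0 :: 'a}))"
    using card.remove[of UNIV "0 :: 'a"] by (simp add: Compl_eq_Diff_UNIV)
  ultimately show ?thesis by simp
qed simp

lemma power_CARD_eq_self_iff:
  fixes x :: "'a :: {field, finite} alg_closure"
  shows "x ^ CARD('a) = x \<longleftrightarrow> x \<in> range (to_ac :: 'a \<Rightarrow> _)"
proof -
  have degree: "degree [:0, 1 :: 'a alg_closure:] < CARD('a)"
    using CARD_field_gt_1[where 'a = 'a] by simp
  have "range (to_ac :: 'a \<Rightarrow> _) \<subseteq> {x. x ^ CARD('a) = x}"
    by (auto simp: power_CARD_eq_self simp flip: to_ac_power)
  moreover have "card (range (to_ac :: 'a \<Rightarrow> _)) = CARD('a)"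
    by (rule card_image[OF inj_to_ac])
  ultimately have "range (to_ac :: 'a \<Rightarrow> _) = {x. x ^ CARD('a) = x}"
    using finite_power_eq_poly[OF degree] card_power_eq_poly_le[OF degree]
    by (intro card_seteq) simp_all
  then show ?thesis by auto
qed

subsection \<open>The torus parametrising the Cayley cubic\<close>

definition torus_trace :: "'k :: field \<Rightarrow> 'k" where
  "torus_trace u = u + inverse u"

lemma torus_trace_inverse [simp]: "torus_trace (inverse u) = torus_trace u"
  by (simp add: torus_trace_def add.commute)

lemma torus_trace_mult: "torus_trace u * torus_trace v = torus_trace (u * v) + torus_trace (u / v)"
  by (simp add: torus_trace_def divide_inverse algebra_simps)

lemma torus_trace_eq_iff:
  assumes "u \<noteq> 0" "v \<noteq> 0"
  shows "torus_trace u = torus_trace v \<longleftrightarrow> u = v \<or> u * v = 1"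
proof -
  have "(u - v) * (u * v - 1) = u * v * (torus_trace u - torus_trace v)"
    using assms by (simp add: torus_trace_def field_simps)
  then show ?thesis using assms by auto
qed

lemma ex_torus_trace_eq:
  fixes x :: "'k :: alg_closed_field"
  shows "\<exists>u. u \<noteq> 0 \<and> torus_trace u = x"
proof -
  obtain u where "poly [:1, - x, 1:] u = 0"
    using alg_closed_imp_poly_has_root[of "[:1, - x, 1:]"] by auto
  then have "u * (x - u) = 1" by (simp add: algebra_simps)
  then have "inverse u = x - u" by (rule inverse_unique)
  then show ?thesis using \<open>u * (x - u) = 1\<close> by (intro exI[of _ u]) (auto simp: torus_trace_def)
qed

definition cayley_point :: "'k :: field \<Rightarrow> 'k \<Rightarrow> 'k \<times> 'k \<times> 'k" where
  "cayley_point u v = (torus_trace u, torus_trace v, torus_trace (u * v))"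

lemma cayley_solutions_torus_trace_iff:
  assumes "u \<noteq> 0" "v \<noteq> 0"
  shows "(torus_trace u, torus_trace v, z) \<in> cayley_solutions \<longleftrightarrow>
    z = torus_trace (u * v) \<or> z = torus_trace (u / v)"
proof -
  have "torus_trace (u * v) * torus_trace (u / v) = (torus_trace u)\<^sup>2 + (torus_trace v)\<^sup>2 - 4"
    using assms by (simp add: torus_trace_def field_simps power2_eq_square)
  then have "(z - torus_trace (u * v)) * (z - torus_trace (u / v)) =
      (torus_trace u)\<^sup>2 + (torus_trace v)\<^sup>2 + z\<^sup>2 - (torus_trace u * torus_trace v * z + 4)"
    unfolding torus_trace_mult[of u v] by (simp add: algebra_simps power2_eq_square)
  then show ?thesis by (auto simp: cayley_solutions_def)
qed

lemma cayley_point_in_solutions: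
  "u \<noteq> 0 \<Longrightarrow> v \<noteq> 0 \<Longrightarrow> cayley_point u v \<in> cayley_solutions"
  by (simp add: cayley_point_def cayley_solutions_torus_trace_iff)

lemma ex_cayley_point:
  fixes s :: "'k :: alg_closed_field \<times> 'k \<times> 'k"
  assumes "s \<in> cayley_solutions"
  shows "\<exists>u v. u \<noteq> 0 \<and> v \<noteq> 0 \<and> s = cayley_point u v"
proof -
  obtain x y z where s: "s = (x, y, z)" by (cases s)
  obtain u v where uv: "u \<noteq> 0" "torus_trace u = x" "v \<noteq> 0" "torus_trace v = y"
    using ex_torus_trace_eq by metis
  then have "z = torus_trace (u * v) \<or> z = torus_trace (u * inverse v)"
    using assms cayley_solutions_torus_trace_iff[of u v z] by (simp add: s divide_inverse)
  then have "s = cayley_point u v \<or> s = cayley_point u (inverse v)"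
    using uv by (auto simp: s cayley_point_def)
  then show ?thesis using uv by (metis nonzero_imp_inverse_nonzero)
qed

lemma cayley_point_eq_iff:
  assumes "u \<noteq> 0" "v \<noteq> 0" "u' \<noteq> 0" "v' \<noteq> 0"
  shows "cayley_point u v = cayley_point u' v' \<longleftrightarrow> u = u' \<and> v = v' \<or> u * u' = 1 \<and> v * v' = 1"
    (is "?eq \<longleftrightarrow> ?R")
proof -
  have "?eq \<longleftrightarrow> (u = u' \<or> u * u' = 1) \<and> (v = v' \<or> v * v' = 1) \<and>
      (u * v = u' * v' \<or> (u * u') * (v * v') = 1)"
    using assms by (simp add: cayley_point_def torus_trace_eq_iff ac_simps)
  also have "\<dots> \<longleftrightarrow> ?R"
  proof -
    have "v = v' \<or> u * u' = 1" if "u = u'" "v * v' = 1" "u * v = u' * v' \<or> (u * u') * (v * v') = 1"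
      using that assms by auto
    moreover have "u = u' \<or> v * v' = 1"
      if "v = v'" "u * u' = 1" "u * v = u' * v' \<or> (u * u') * (v * v') = 1"
      using that assms by auto
    ultimately show ?thesis by auto
  qed
  finally show ?thesis .
qed

abbreviation to_ac_triple ::
  "'a :: field \<times> 'a \<times> 'a \<Rightarrow> 'a alg_closure \<times> 'a alg_closure \<times> 'a alg_closure" where
  "to_ac_triple \<equiv> map_prod to_ac (map_prod to_ac to_ac)"

lemma to_ac_triple_eq_iff: "to_ac_triple s = to_ac_triple s' \<longleftrightarrow> s = s'"
  by (cases s; cases s') simp

lemma to_ac_triple_in_solutions_iff:
  "to_ac_triple s \<in> cayley_solutions \<longleftrightarrow> s \<in> cayley_solutions"
proof (cases s)
  case (fields x y z)
  have "to_ac (x\<^sup>2 + y\<^sup>2 + z\<^sup>2) = to_ac (x * y * z + 4) \<longleftrightarrow> x\<^sup>2 + y\<^sup>2 + z\<^sup>2 = x * y * z + 4"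
    by (rule to_ac_eq_iff)
  then show ?thesis by (simp add: fields cayley_solutions_def del: to_ac_eq_iff)
qed

lemma torus_trace_in_range_to_ac_iff:
  fixes u :: "'a :: {field, finite} alg_closure"
  assumes "u \<noteq> 0"
  shows "torus_trace u \<in> range (to_ac :: 'a \<Rightarrow> _) \<longleftrightarrow> u ^ (CARD('a) + 1) = 1 \<or> u ^ (CARD('a) - 1) = 1"
proof -
  have "torus_trace u \<in> range (to_ac :: 'a \<Rightarrow> _) \<longleftrightarrow> torus_trace (u ^ CARD('a)) = torus_trace u"
    by (simp add: torus_trace_def add_power_CARD power_inverse flip: power_CARD_eq_self_iff)
  also have "\<dots> \<longleftrightarrow> u ^ CARD('a) = u \<or> u ^ CARD('a) * u = 1"
    using assms by (simp add: torus_trace_eq_iff)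
  also have "u ^ CARD('a) = u \<longleftrightarrow> u ^ (CARD('a) - 1) = 1"
    using assms power_minus_mult[of "CARD('a)" u] by auto
  finally show ?thesis by (auto simp: mult.commute)
qed

subsection \<open>Orbits of the Markoff group\<close>

abbreviation cayley_orbit :: "'k :: field \<times> 'k \<times> 'k \<Rightarrow> ('k \<times> 'k \<times> 'k) set" where
  "cayley_orbit \<equiv> orbit cayley_group (\<lambda>m. m)"

lemma subgroup_generate_BijGroup:
  "H \<subseteq> Bij E \<Longrightarrow> subgroup (generate (BijGroup E) H) (BijGroup E)"
  by (intro group.generate_is_subgroup group_BijGroup) (simp add: BijGroup_def)

lemma generate_BijGroup_invariant:
  assumes "h \<in> generate (BijGroup E) H" and H: "H \<subseteq> Bij E"
    and f_eq: "\<And>m s. m \<in> H \<Longrightarrow> s \<in> E \<Longrightarrow> f (m s) = f s"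
    and "s \<in> E"
  shows "f (h s) = f s"
  using assms(1) \<open>s \<in> E\<close>
proof (induction h arbitrary: s rule: generate.induct)
  case one
  then show ?case by (simp add: BijGroup_def)
next
  case (incl m)
  then show ?case by (rule f_eq)
next
  case (inv m)
  then have "m \<in> Bij E" using H by blast
  then have "inv_into E m s \<in> E" "m (inv_into E m s) = s"
    using inv.prems by (auto simp: Bij_def bij_betw_def inv_into_into f_inv_into_f)
  then have "f (inv_into E m s) = f s" using f_eq[OF inv.hyps] by metis
  then show ?case using inv.prems by (simp add: inv_BijGroup[OF \<open>m \<in> Bij E\<close>])
next
  case (eng h1 h2)
  have "h1 \<in> Bij E" "h2 \<in> Bij E"
    using eng.hyps subgroup.subset[OF subgroup_generate_BijGroup[OF H]] by (auto simp: BijGroup_def)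
  then have "h2 s \<in> E" using eng.prems Bij_imp_funcset by blast
  then show ?case
    using eng \<open>h1 \<in> Bij E\<close> \<open>h2 \<in> Bij E\<close> by (simp add: BijGroup_def compose_def)
qed

lemma group_action_cayley_group:
  "group_action cayley_group (cayley_solutions :: ('k :: field \<times> 'k \<times> 'k) set) (\<lambda>m. m)"
proof -
  let ?B = "BijGroup (cayley_solutions :: ('k \<times> 'k \<times> 'k) set)"
  have "subgroup (generate ?B cayley_generators) ?B"
    by (rule subgroup_generate_BijGroup[OF cayley_generators_subset_Bij])
  then have "group_hom cayley_group ?B (\<lambda>m. m)"
    unfolding cayley_group_def
    using group.canonical_inj_is_hom[OF group_BijGroup] by (simp add: id_def)
  then show ?thesis by (rule group_action.intro)
qed

lemma cayley_orbit_generator: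
  assumes "m \<in> markoff_moves \<union> coordinate_permutations" "s \<in> cayley_solutions"
  shows "cayley_orbit (m s) = cayley_orbit s"
proof -
  interpret group_action cayley_group cayley_solutions "\<lambda>m. m"
    by (rule group_action_cayley_group)
  have restrict_in_carrier: "restrict m cayley_solutions \<in> carrier cayley_group"
    using assms(1) by (auto simp: cayley_group_def cayley_generators_def intro: generate.incl)
  have restrict_eq: "restrict m cayley_solutions s = m s" using assms(2) by simp
  have "m s \<in> cayley_solutions" by (rule element_image[OF restrict_in_carrier assms(2) restrict_eq])
  moreover have "m s \<in> cayley_orbit s"
    unfolding orbit_def
    using restrict_in_carrier restrict_eq by (metis (mono_tags, lifting) mem_Collect_eq)
  ultimately show ?thesis
    using disjoint_union[of "cayley_orbit (m s)" "cayley_orbit s"]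
      orbit_refl[of "m s"] assms(2) unfolding orbits_def by blast
qed

lemma cayley_generator_mem_iff:
  assumes swap_xy: "\<And>x y z. (x, y, z) \<in> S \<Longrightarrow> (y, x, z) \<in> S"
    and swap_yz: "\<And>x y z. (x, y, z) \<in> S \<Longrightarrow> (x, z, y) \<in> S"
    and vieta_z: "\<And>x y z. (x, y, z) \<in> S \<Longrightarrow> (x, y, x * y - z) \<in> S"
    and generator: "m \<in> markoff_moves \<union> coordinate_permutations"
  shows "m s \<in> S \<longleftrightarrow> s \<in> S"
proof (cases s)
  case (fields x y z)
  have swap_xy_iff: "(y, x, z) \<in> S \<longleftrightarrow> (x, y, z) \<in> S" for x y z
    using swap_xy by blast
  have swap_yz_iff: "(x, z, y) \<in> S \<longleftrightarrow> (x, y, z) \<in> S" for x y z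
    using swap_yz by blast
  have vieta_z_iff: "(x, y, x * y - z) \<in> S \<longleftrightarrow> (x, y, z) \<in> S" for x y z
    using vieta_z[of x y z] vieta_z[of x y "x * y - z"] by auto
  \<comment> \<open>The first two moves are conjugates of the third by transpositions.\<close>
  have "(y * z - x, y, z) \<in> S \<longleftrightarrow> (x, y, z) \<in> S" "(x, x * z - y, z) \<in> S \<longleftrightarrow> (x, y, z) \<in> S"
    by (metis swap_xy_iff swap_yz_iff vieta_z_iff)+
  moreover have "(y, z, x) \<in> S \<longleftrightarrow> (x, y, z) \<in> S" "(z, x, y) \<in> S \<longleftrightarrow> (x, y, z) \<in> S"
      "(z, y, x) \<in> S \<longleftrightarrow> (x, y, z) \<in> S"
    by (metis swap_xy_iff swap_yz_iff)+
  ultimately show ?thesis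
    using generator swap_xy_iff swap_yz_iff vieta_z_iff
    unfolding fields markoff_moves_def coordinate_permutations_def by auto
qed

lemma cayley_orbit_subset:
  fixes S :: "('k :: field \<times> 'k \<times> 'k) set"
  assumes "S \<subseteq> cayley_solutions"
    and closed: "\<And>x y z. (x, y, z) \<in> S \<Longrightarrow> (y, x, z) \<in> S"
      "\<And>x y z. (x, y, z) \<in> S \<Longrightarrow> (x, z, y) \<in> S"
      "\<And>x y z. (x, y, z) \<in> S \<Longrightarrow> (x, y, x * y - z) \<in> S"
    and "s \<in> S"
  shows "cayley_orbit s \<subseteq> S"
proof
  fix s' assume "s' \<in> cayley_orbit s"
  then obtain h where h: "h \<in> generate (BijGroup cayley_solutions) cayley_generators" "s' = h s"
    by (auto simp: orbit_def cayley_group_def)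
  have "m x \<in> S \<longleftrightarrow> x \<in> S" if "m \<in> cayley_generators" "x \<in> cayley_solutions"
    for m and x :: "'k \<times> 'k \<times> 'k"
  proof -
    from \<open>m \<in> cayley_generators\<close> obtain m' where m': "m = restrict m' cayley_solutions"
        "m' \<in> markoff_moves \<union> coordinate_permutations"
      by (auto simp: cayley_generators_def)
    then show ?thesis
      using cayley_generator_mem_iff[OF closed m'(2), of x] \<open>x \<in> cayley_solutions\<close> by simp
  qed
  then have "h s \<in> S \<longleftrightarrow> s \<in> S"
    using generate_BijGroup_invariant[OF h(1) cayley_generators_subset_Bij, of "\<lambda>s. s \<in> S" s] assms
    by blast
  then show "s' \<in> S" using \<open>s \<in> S\<close> h(2) by blast
qed

lemma GL2_invariant_eq_gcd:
  fixes F :: "int \<Rightarrow> int \<Rightarrow> 'b"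
  assumes swap: "\<And>a b. gcd a b = d \<Longrightarrow> F b a = F a b"
    and neg: "\<And>a b. gcd a b = d \<Longrightarrow> F a (- b) = F a b"
    and add: "\<And>a b. gcd a b = d \<Longrightarrow> F a (b + a) = F a b"
    and gcd_ab: "gcd a b = d"
  shows "F a b = F d 0"
proof -
  have add_mult: "F a (b + int k * a) = F a b" if "gcd a b = d" for a b k
  proof (induction k)
    case (Suc k)
    have "gcd a (b + int k * a) = d" using that by (metis gcd_add_mult add.commute mult.commute)
    from add[OF this] Suc show ?case by (simp add: algebra_simps)
  qed simp
  have nonneg: "F (int m) (int n) = F d 0" if "gcd (int m) (int n) = d" for m n
    using that
  proof (induction m n rule: gcd_nat_induct)
    case (step m n)
    have m_eq: "int m = int (m mod n) + int (m div n) * int n"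
      by (metis mod_div_mult_eq of_nat_add of_nat_mult)
    have gcd_mod: "gcd (int n) (int (m mod n)) = d"
      using step.prems by (simp add: gcd_red_nat[of m n])
    have "F (int m) (int n) = F (int n) (int m)"
      using step.prems by (simp add: swap gcd.commute)
    also have "\<dots> = F (int n) (int (m mod n))" by (subst m_eq) (rule add_mult[OF gcd_mod])
    also have "\<dots> = F d 0" by (rule step.IH[OF gcd_mod])
    finally show ?case .
  qed auto
  have abs_right: "F a \<bar>b\<bar> = F a b" if "gcd a b = d" for a b
    using neg[OF that] by (simp add: abs_if)
  have "F a b = F \<bar>b\<bar> a" using gcd_ab by (simp add: abs_right swap)
  also have "\<dots> = F \<bar>b\<bar> \<bar>a\<bar>" using gcd_ab by (simp add: abs_right gcd.commute)
  also have "\<dots> = F d 0"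
    using nonneg[of "nat \<bar>b\<bar>" "nat \<bar>a\<bar>"] gcd_ab by (simp add: gcd.commute)
  finally show ?thesis .
qed

subsection \<open>Exponents of a primitive root\<close>

locale cayley_exponents =
  fixes q :: nat and g :: "'a :: {field, finite} alg_closure"
  assumes CARD_eq: "CARD('a) = q" and primitive_g: "primitive_root_of_unity (q\<^sup>2 - 1) g"
begin

definition N :: nat where
  "N = q\<^sup>2 - 1"

lemma q_gt_1: "q > 1"
  using CARD_field_gt_1[where 'a = 'a] by (simp add: CARD_eq)

lemma N_pos: "N > 0"
  using one_less_power[OF q_gt_1, of 2] by (simp add: N_def)

lemma int_N: "int N = (int q + 1) * (int q - 1)"
  unfolding N_def square_minus_1_nat of_nat_mult using q_gt_1 by (simp add: of_nat_diff)

lemma g_nonzero: "g \<noteq> 0"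
  using primitive_g N_pos unfolding N_def by (rule primitive_root_of_unity_nonzero)

lemma g_powi_eq_1_iff: "g powi k = 1 \<longleftrightarrow> int N dvd k"
  unfolding N_def using primitive_g by (rule primitive_root_of_unity_powi_eq_1_iff)

lemma g_powi_add: "g powi (a + b) = g powi a * g powi b"
  using g_nonzero by (simp add: power_int_add)

lemma g_powi_eq_iff: "g powi a = g powi b \<longleftrightarrow> [a = b] (mod int N)"
proof -
  have "g powi a = g powi b \<longleftrightarrow> g powi (a - b) = 1"
    using g_nonzero by (simp add: power_int_diff)
  then show ?thesis by (simp only: g_powi_eq_1_iff cong_iff_dvd_diff)
qed

definition rational_exponent :: "int \<Rightarrow> bool" where
  "rational_exponent a \<longleftrightarrow> int q + 1 dvd a \<or> int q - 1 dvd a"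

lemma rational_exponent_dvd: "rational_exponent a \<Longrightarrow> a dvd b \<Longrightarrow> rational_exponent b"
  by (auto simp: rational_exponent_def intro: dvd_trans)

lemma rational_exponent_gcd_N: "rational_exponent (gcd a (int N)) \<longleftrightarrow> rational_exponent a"
  by (auto simp: rational_exponent_def int_N)

lemma rational_exponent_gcdI:
  assumes "rational_exponent a" "rational_exponent b" "rational_exponent (a + b)"
  shows "rational_exponent (gcd a b)"
  using assms unfolding rational_exponent_def
  by (metis dvd_add_left_iff dvd_add_right_iff gcd_greatest)

lemma torus_trace_powi_in_range_to_ac_iff:
  "torus_trace (g powi a) \<in> range (to_ac :: 'a \<Rightarrow> _) \<longleftrightarrow> rational_exponent a"
proof -
  have "(g powi a) ^ k = 1 \<longleftrightarrow> int N dvd a * int k" for k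
    by (simp only: g_powi_eq_1_iff power_int_power')
  moreover have "int N dvd a * int (q + 1) \<longleftrightarrow> int q - 1 dvd a"
      "int N dvd a * int (q - 1) \<longleftrightarrow> int q + 1 dvd a"
    using q_gt_1 unfolding int_N mult.commute[of a] by (simp_all add: of_nat_diff add.commute)
  moreover have "g powi a \<noteq> 0" using g_nonzero by simp
  ultimately show ?thesis
    unfolding torus_trace_in_range_to_ac_iff[OF \<open>g powi a \<noteq> 0\<close>] CARD_eq rational_exponent_def
    by blast
qed

text \<open>Junk unless \<open>rational_exponent (gcd a b)\<close>: only then are all arguments of \<^const>\<open>of_ac\<close> in
  the range of \<^const>\<open>to_ac\<close>.\<close>

definition cayley_triple :: "int \<Rightarrow> int \<Rightarrow> 'a \<times> 'a \<times> 'a" where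
  "cayley_triple a b = map_prod of_ac (map_prod of_ac of_ac) (cayley_point (g powi a) (g powi b))"

lemma to_ac_cayley_triple:
  assumes "rational_exponent (gcd a b)"
  shows "to_ac_triple (cayley_triple a b) = cayley_point (g powi a) (g powi b)"
proof -
  have "rational_exponent a" "rational_exponent b" "rational_exponent (a + b)"
    using assms by (auto intro: rational_exponent_dvd)
  then have "to_ac (of_ac (torus_trace (g powi c)) :: 'a) = torus_trace (g powi c)"
    if "c \<in> {a, b, a + b}" for c
    using that by (intro to_ac_of_ac) (auto simp: torus_trace_powi_in_range_to_ac_iff)
  then show ?thesis by (simp add: cayley_triple_def cayley_point_def flip: g_powi_add)
qed

lemma ex_powi_eq_if_torus_trace_rational:
  fixes x :: 'a
  assumes "u \<noteq> 0" "torus_trace u = to_ac x"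
  shows "\<exists>a. u = g powi a"
proof -
  have "u ^ (q + 1) = 1 \<or> u ^ (q - 1) = 1"
    using torus_trace_in_range_to_ac_iff[OF assms(1)] assms(2) by (auto simp: CARD_eq)
  then have "u ^ N = 1"
    unfolding N_def square_minus_1_nat by (metis mult.commute power_mult power_one)
  then obtain k where "u = g ^ k"
    using powers_of_primitive_root_of_unity[of N g] primitive_g N_pos unfolding N_def by blast
  then show ?thesis by (metis power_int_of_nat)
qed

lemma cayley_triple_in_solutions:
  "rational_exponent (gcd a b) \<Longrightarrow> cayley_triple a b \<in> cayley_solutions"
  using cayley_point_in_solutions[of "g powi a" "g powi b"] g_nonzero
  by (simp add: to_ac_cayley_triple
      to_ac_triple_in_solutions_iff[of "cayley_triple a b", symmetric])

lemma cayley_solutions_eq: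
  "cayley_solutions = {cayley_triple a b | a b. rational_exponent (gcd a b)}"
proof (intro equalityI subsetI)
  fix s :: "'a \<times> 'a \<times> 'a" assume "s \<in> cayley_solutions"
  then obtain u v where uv: "u \<noteq> 0" "v \<noteq> 0" "to_ac_triple s = cayley_point u v"
    using ex_cayley_point to_ac_triple_in_solutions_iff by metis
  obtain x y z where "s = (x, y, z)" by (cases s)
  then have xyz: "torus_trace u = to_ac x" "torus_trace v = to_ac y" "torus_trace (u * v) = to_ac z"
    using uv(3) by (simp_all add: cayley_point_def)
  obtain a b where ab: "u = g powi a" "v = g powi b"
    using ex_powi_eq_if_torus_trace_rational uv(1,2) xyz(1,2) by metis
  then have "rational_exponent (gcd a b)"
    using xyz
    by (intro rational_exponent_gcdI)
       (simp_all add: g_powi_add flip: torus_trace_powi_in_range_to_ac_iff)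
  moreover from this have "to_ac_triple s = to_ac_triple (cayley_triple a b)"
    using uv(3) by (simp add: ab to_ac_cayley_triple)
  then have "s = cayley_triple a b" by (simp only: to_ac_triple_eq_iff)
  ultimately show "s \<in> {cayley_triple a b | a b. rational_exponent (gcd a b)}" by blast
next
  fix s assume "s \<in> {cayley_triple a b | a b. rational_exponent (gcd a b)}"
  then show "s \<in> cayley_solutions" using cayley_triple_in_solutions by blast
qed

lemma cayley_triple_eq_iff:
  assumes "rational_exponent (gcd a b)" "rational_exponent (gcd a' b')"
  shows "cayley_triple a b = cayley_triple a' b' \<longleftrightarrow>
    [a = a'] (mod int N) \<and> [b = b'] (mod int N) \<or> [a = - a'] (mod int N) \<and> [b = - b'] (mod int N)"
proof -
  have "g powi c * g powi d = 1 \<longleftrightarrow> [c = - d] (mod int N)" for c d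
    by (simp add: g_powi_eq_1_iff cong_iff_dvd_diff flip: g_powi_add)
  then show ?thesis
    using cayley_point_eq_iff[of "g powi a" "g powi b" "g powi a'" "g powi b'"] g_nonzero assms
    by (simp add: g_powi_eq_iff to_ac_cayley_triple
        to_ac_triple_eq_iff[of "cayley_triple a b", symmetric])
qed

lemma gcd_eq_if_cayley_triple_eq:
  assumes "rational_exponent (gcd a b)" "rational_exponent (gcd a' b')"
    and "cayley_triple a b = cayley_triple a' b'"
  shows "gcd (gcd a b) (int N) = gcd (gcd a' b') (int N)"
proof -
  have "gcd (gcd c d) (int N) = gcd (gcd c' d') (int N)"
    if "[c = c'] (mod int N)" "[d = d'] (mod int N)" for c d c' d'
    using that gcd_gcd_mod[of c "int N" d] gcd_gcd_mod[of c' "int N" d'] by (simp add: cong_def)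
  from this[of a a' b b'] this[of a "- a'" b "- b'"] show ?thesis
    using assms(3) unfolding cayley_triple_eq_iff[OF assms(1,2)] by auto
qed

definition exponent_class :: "nat \<Rightarrow> ('a \<times> 'a \<times> 'a) set" where
  "exponent_class t = {cayley_triple a b | a b. gcd (gcd a b) (int N) = int t}"

lemma D_set_iff: "t \<in> D_set q \<longleftrightarrow> t dvd N \<and> rational_exponent (int t)"
proof -
  have "q + 1 dvd t \<longleftrightarrow> int q + 1 dvd int t" "q - 1 dvd t \<longleftrightarrow> int q - 1 dvd int t"
    using int_dvd_int_iff[of "q + 1" t] int_dvd_int_iff[of "q - 1" t] q_gt_1
    by (simp_all add: of_nat_diff add.commute)
  then show ?thesis by (simp add: D_set_def rational_exponent_def N_def)
qed

lemma rational_exponent_if_gcd_in_D_set: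
  assumes "t \<in> D_set q" "gcd (gcd a b) (int N) = int t"
  shows "rational_exponent (gcd a b)"
  using assms rational_exponent_gcd_N[of "gcd a b"] by (simp add: D_set_iff)

lemma cayley_triple_swap:
  "(\<lambda>(x, y, z). (y, x, z)) (cayley_triple a b) = cayley_triple b a"
  by (simp add: cayley_triple_def cayley_point_def mult.commute)

lemma cayley_triple_neg_add:
  "(\<lambda>(x, y, z). (x, z, y)) (cayley_triple a b) = cayley_triple (- a) (a + b)"
  using g_nonzero
  by (simp add: cayley_triple_def cayley_point_def g_powi_add power_int_minus flip: mult.assoc)

lemma cayley_triple_neg:
  assumes "rational_exponent (gcd a b)"
  shows "(\<lambda>(x, y, z). (x, y, x * y - z)) (cayley_triple a b) = cayley_triple a (- b)"
proof (cases "cayley_triple a b")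
  case (fields x y z)
  have "to_ac_triple (x, y, x * y - z) = cayley_point (g powi a) (g powi (- b))"
    using to_ac_cayley_triple[OF assms] torus_trace_mult[of "g powi a" "g powi b"]
    by (simp add: fields cayley_point_def power_int_minus divide_inverse)
  also have "\<dots> = to_ac_triple (cayley_triple a (- b))"
    using assms by (simp add: to_ac_cayley_triple)
  finally show ?thesis unfolding fields by (simp only: to_ac_triple_eq_iff prod.case)
qed

lemma cayley_orbit_swap:
  assumes "rational_exponent (gcd a b)"
  shows "cayley_orbit (cayley_triple b a) = cayley_orbit (cayley_triple a b)"
  using cayley_orbit_generator[of "\<lambda>(x, y, z). (y, x, z)" "cayley_triple a b"]
    cayley_triple_in_solutions[OF assms]
  by (simp add: coordinate_permutations_def cayley_triple_swap)

lemma cayley_orbit_neg: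
  assumes "rational_exponent (gcd a b)"
  shows "cayley_orbit (cayley_triple a (- b)) = cayley_orbit (cayley_triple a b)"
  using cayley_orbit_generator[of "\<lambda>(x, y, z). (x, y, x * y - z)" "cayley_triple a b"]
    cayley_triple_in_solutions[OF assms] assms
  by (simp add: markoff_moves_def cayley_triple_neg)

lemma cayley_orbit_add:
  assumes "rational_exponent (gcd a b)"
  shows "cayley_orbit (cayley_triple a (b + a)) = cayley_orbit (cayley_triple a b)"
proof -
  have rational: "rational_exponent (gcd (a + b) a)" "rational_exponent (gcd (a + b) (- a))"
    using assms by (simp_all add: gcd.commute[of _ a])
  have "cayley_orbit (cayley_triple a (b + a)) = cayley_orbit (cayley_triple (a + b) a)"
    using cayley_orbit_swap[OF rational(1)] by (simp add: add.commute)
  also have "\<dots> = cayley_orbit (cayley_triple (a + b) (- a))"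
    by (rule cayley_orbit_neg[OF rational(1), symmetric])
  also have "\<dots> = cayley_orbit (cayley_triple (- a) (a + b))"
    by (rule cayley_orbit_swap[OF rational(2), symmetric])
  also have "\<dots> = cayley_orbit (cayley_triple a b)"
    using cayley_orbit_generator[of "\<lambda>(x, y, z). (x, z, y)" "cayley_triple a b"]
      cayley_triple_in_solutions[OF assms]
    by (simp add: coordinate_permutations_def cayley_triple_neg_add)
  finally show ?thesis .
qed

lemma cayley_orbit_gcd:
  assumes "rational_exponent (gcd a b)"
  shows "cayley_orbit (cayley_triple a b) = cayley_orbit (cayley_triple (gcd a b) 0)"
proof (rule GL2_invariant_eq_gcd[where d = "gcd a b"])
  fix c d assume "gcd c d = gcd a b"
  then have "rational_exponent (gcd c d)" using assms by simp
  then show "cayley_orbit (cayley_triple d c) = cayley_orbit (cayley_triple c d)"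
    "cayley_orbit (cayley_triple c (- d)) = cayley_orbit (cayley_triple c d)"
    "cayley_orbit (cayley_triple c (d + c)) = cayley_orbit (cayley_triple c d)"
    by (fact cayley_orbit_swap cayley_orbit_neg cayley_orbit_add)+
qed (rule refl)

lemma cayley_orbit_gcd_gcd_N:
  assumes "rational_exponent (gcd a b)"
  shows "cayley_orbit (cayley_triple a b) = cayley_orbit (cayley_triple (gcd (gcd a b) (int N)) 0)"
proof -
  have "cayley_orbit (cayley_triple a b) = cayley_orbit (cayley_triple (gcd a b) 0)"
    using assms by (rule cayley_orbit_gcd)
  also have "cayley_triple (gcd a b) 0 = cayley_triple (gcd a b) (int N)"
    using assms by (subst cayley_triple_eq_iff) (simp_all add: rational_exponent_gcd_N cong_def)
  also have "cayley_orbit \<dots> = cayley_orbit (cayley_triple (gcd (gcd a b) (int N)) 0)"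
    using assms by (intro cayley_orbit_gcd) (simp add: rational_exponent_gcd_N)
  finally show ?thesis .
qed

lemma exponent_class_subset_solutions:
  "t \<in> D_set q \<Longrightarrow> exponent_class t \<subseteq> cayley_solutions"
  using rational_exponent_if_gcd_in_D_set cayley_triple_in_solutions
  unfolding exponent_class_def by blast

lemma cayley_triple_in_exponent_class: "t \<in> D_set q \<Longrightarrow> cayley_triple (int t) 0 \<in> exponent_class t"
  by (force simp: exponent_class_def D_set_iff intro: gcd_nat.absorb1)

lemma cayley_orbit_eq_exponent_class:
  assumes t: "t \<in> D_set q"
  shows "cayley_orbit (cayley_triple (int t) 0) = exponent_class t"
proof
  show "cayley_orbit (cayley_triple (int t) 0) \<subseteq> exponent_class t"
  proof (rule cayley_orbit_subset)
    fix x y z assume "(x, y, z) \<in> exponent_class t"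
    then obtain a b where ab: "cayley_triple a b = (x, y, z)" "gcd (gcd a b) (int N) = int t"
      by (auto simp: exponent_class_def)
    have "cayley_triple b a = (y, x, z)" "cayley_triple (- a) (a + b) = (x, z, y)"
      "cayley_triple a (- b) = (x, y, x * y - z)"
      using ab(1) cayley_triple_swap[of a b] cayley_triple_neg_add[of a b]
        cayley_triple_neg[OF rational_exponent_if_gcd_in_D_set[OF t ab(2)]] by simp_all
    moreover have "gcd b a = gcd a b" "gcd (- a) (a + b) = gcd a b" "gcd a (- b) = gcd a b"
      by (simp_all add: gcd.commute)
    ultimately show "(y, x, z) \<in> exponent_class t" "(x, z, y) \<in> exponent_class t"
      "(x, y, x * y - z) \<in> exponent_class t"
      unfolding exponent_class_def using ab(2) by (metis (mono_tags, lifting) mem_Collect_eq)+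
  qed (use t exponent_class_subset_solutions cayley_triple_in_exponent_class in auto)
  show "exponent_class t \<subseteq> cayley_orbit (cayley_triple (int t) 0)"
  proof
    fix s assume s: "s \<in> exponent_class t"
    then obtain a b where ab: "s = cayley_triple a b" "gcd (gcd a b) (int N) = int t"
      by (auto simp: exponent_class_def)
    have "s \<in> cayley_orbit s"
      using s t exponent_class_subset_solutions
        group_action.orbit_refl[OF group_action_cayley_group] by blast
    then show "s \<in> cayley_orbit (cayley_triple (int t) 0)"
      using cayley_orbit_gcd_gcd_N[OF rational_exponent_if_gcd_in_D_set[OF t ab(2)]]
      by (simp only: ab)
  qed
qed

lemma inj_on_exponent_class: "inj_on exponent_class (D_set q)"
proof (rule inj_onI)
  fix t t' assume t: "t \<in> D_set q" "t' \<in> D_set q" and "exponent_class t = exponent_class t'"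
  then have "cayley_triple (int t) 0 \<in> exponent_class t'"
    using cayley_triple_in_exponent_class by blast
  then obtain a b where "cayley_triple (int t) 0 = cayley_triple a b"
      "gcd (gcd a b) (int N) = int t'"
    by (auto simp: exponent_class_def)
  then show "t = t'"
    using gcd_eq_if_cayley_triple_eq[of "int t" 0 a b]
      rational_exponent_if_gcd_in_D_set[OF t(2)] t(1)
    by (simp add: D_set_iff)
qed

lemma exponent_class_image_D_set: "exponent_class ` D_set q = cayley_orbits"
proof (intro equalityI subsetI)
  fix S assume "S \<in> exponent_class ` D_set q"
  then show "S \<in> cayley_orbits"
    using cayley_orbit_eq_exponent_class cayley_triple_in_exponent_class
      exponent_class_subset_solutions
    unfolding cayley_orbits_def orbits_def by blast
next
  fix S :: "('a \<times> 'a \<times> 'a) set" assume "S \<in> cayley_orbits"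
  then obtain a b where ab: "rational_exponent (gcd a b)" "S = cayley_orbit (cayley_triple a b)"
    unfolding cayley_orbits_def orbits_def cayley_solutions_eq by blast
  define t where "t = nat (gcd (gcd a b) (int N))"
  then have t: "int t = gcd (gcd a b) (int N)" by simp
  then have "t \<in> D_set q"
    using ab(1) by (simp add: D_set_iff rational_exponent_gcd_N flip: int_dvd_int_iff)
  moreover have "S = exponent_class t"
    unfolding ab(2) cayley_orbit_gcd_gcd_N[OF ab(1)] t[symmetric]
    using \<open>t \<in> D_set q\<close> by (rule cayley_orbit_eq_exponent_class)
  ultimately show "S \<in> exponent_class ` D_set q" by blast
qed

lemma bij_betw_exponent_class: "bij_betw exponent_class (D_set q) cayley_orbits"
  using inj_on_exponent_class exponent_class_image_D_set by (simp add: bij_betw_def)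

lemma exponent_class_eq_image:
  assumes t: "t \<in> D_set q"
  shows "exponent_class t = (\<lambda>(a, b). cayley_triple (int a) (int b)) ` gcd_pairs N t"
proof (intro equalityI subsetI)
  fix s assume "s \<in> exponent_class t"
  then obtain a b where ab: "s = cayley_triple a b" "gcd (gcd a b) (int N) = int t"
    by (auto simp: exponent_class_def)
  define a' b' where "a' = nat (a mod int N)" and "b' = nat (b mod int N)"
  have reduced: "int a' = a mod int N" "int b' = b mod int N"
    using N_pos by (simp_all add: a'_def b'_def)
  then have gcd_reduced: "gcd (gcd (int a') (int b')) (int N) = int t"
    by (simp add: gcd_gcd_mod ab(2))
  moreover have "a' < N" "b' < N" using N_pos by (simp_all add: a'_def b'_def nat_less_iff)
  ultimately have "(a', b') \<in> gcd_pairs N t" by (simp add: gcd_pairs_below_iff)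
  moreover have "s = cayley_triple (int a') (int b')"
    unfolding ab(1) using ab(2) gcd_reduced rational_exponent_if_gcd_in_D_set[OF t]
    by (subst cayley_triple_eq_iff) (auto simp: reduced cong_def)
  ultimately show "s \<in> (\<lambda>(a, b). cayley_triple (int a) (int b)) ` gcd_pairs N t" by force
qed (force simp: exponent_class_def gcd_pairs_below_iff)

lemma cayley_triple_eq_on_gcd_pairs_iff:
  assumes t: "t \<in> D_set q" and ab: "(a, b) \<in> gcd_pairs N t" and cd: "(c, d) \<in> gcd_pairs N t"
  shows "cayley_triple (int c) (int d) = cayley_triple (int a) (int b) \<longleftrightarrow>
    (c, d) = (a, b) \<or> (c, d) = ((N - a) mod N, (N - b) mod N)"
proof -
  have cong_iff: "[int y = int x] (mod int N) \<longleftrightarrow> y = x"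
      "[int y = - int x] (mod int N) \<longleftrightarrow> y = (N - x) mod N"
    if "x < N" "y < N" for x y
  proof -
    show "[int y = int x] (mod int N) \<longleftrightarrow> y = x" using that by (simp add: cong_int_iff cong_def)
    have "[int y = - int x] (mod int N) \<longleftrightarrow> N dvd y + x"
      by (simp add: cong_iff_dvd_diff flip: of_nat_add int_dvd_int_iff)
    then show "[int y = - int x] (mod int N) \<longleftrightarrow> y = (N - x) mod N"
      using that by (simp add: dvd_add_iff_eq_diff_mod)
  qed
  have "rational_exponent (gcd (int x) (int y))" if "(x, y) \<in> gcd_pairs N t" for x y
    using t that by (intro rational_exponent_if_gcd_in_D_set) (simp_all add: gcd_pairs_below_iff)
  then show ?thesis
    using ab cd cayley_triple_eq_iff cong_iff by (simp add: gcd_pairs_below_iff)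
qed

lemma card_gcd_pairs_eq_card_exponent_class:
  assumes t: "t \<in> D_set q"
  shows "card (gcd_pairs N t) = (if N dvd 2 * t then 1 else 2) * card (exponent_class t)"
  unfolding exponent_class_eq_image[OF t]
proof (rule card_fibres)
  let ?F = "\<lambda>(a, b). cayley_triple (int a) (int b)"
  fix x assume "x \<in> gcd_pairs N t"
  then obtain a b where x_eq: "x = (a, b)" and ab: "(a, b) \<in> gcd_pairs N t" by (cases x) simp
  let ?neg = "((N - a) mod N, (N - b) mod N)"
  have "{y \<in> gcd_pairs N t. ?F y = ?F x} = {(a, b), ?neg}"
    using cayley_triple_eq_on_gcd_pairs_iff[OF t ab] ab diff_mod_in_gcd_pairs[OF ab]
    by (auto simp: x_eq)
  moreover have "?neg = (a, b) \<longleftrightarrow> N dvd 2 * t"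
    using ab dvd_add_iff_eq_diff_mod[of a N a] dvd_add_iff_eq_diff_mod[of b N b]
      dvd_mult_gcd_pairs_iff[OF ab, of 2]
    by (auto simp: gcd_pairs_below_iff mult_2)
  ultimately show "card {y \<in> gcd_pairs N t. ?F y = ?F x} = (if N dvd 2 * t then 1 else 2)"
    by (auto simp: card_insert_if)
qed simp

lemma card_exponent_class:
  assumes "t \<in> D_set q" "odd q"
  shows "real (card (exponent_class t)) = (if t = N \<or> t = N div 2 then 2 else 1) * size_expr q t"
proof -
  have "t dvd N" using assms(1) by (simp add: D_set_iff)
  then have "card (gcd_pairs N t) = jordan_totient_2 (N div t)"
    using N_pos by (rule card_gcd_pairs)
  moreover have "size_expr q t = real (jordan_totient_2 (N div t)) / 2"
    using \<open>t dvd N\<close> q_gt_1 unfolding N_def by (rule size_expr_eq_jordan_totient_2)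
  moreover have "N dvd 2 * t \<longleftrightarrow> t = N \<or> t = N div 2"
    using assms(2) N_pos \<open>t dvd N\<close> by (intro dvd_double_iff) (simp_all add: N_def)
  ultimately show ?thesis using card_gcd_pairs_eq_card_exponent_class[OF assms(1)] by auto
qed

end

lemma ex_cayley_exponents:
  assumes "CARD('a :: {field, finite}) = q"
  shows "\<exists>g :: 'a alg_closure. cayley_exponents q g"
proof -
  have "q > 1" using CARD_field_gt_1[where 'a = 'a] assms by simp
  have "\<not> CHAR('a) dvd q\<^sup>2 - 1"
  proof
    assume "CHAR('a) dvd q\<^sup>2 - 1"
    moreover have "CHAR('a) dvd q\<^sup>2"
      using CHAR_dvd_CARD[where 'a = 'a] assms by (simp add: power2_eq_square)
    ultimately have "CHAR('a) dvd q\<^sup>2 - (q\<^sup>2 - 1)" by (rule dvd_diff_nat[rotated])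
    then show False using \<open>q > 1\<close> by simp
  qed
  then have "of_nat (q\<^sup>2 - 1) \<noteq> (0 :: 'a alg_closure)"
    by (simp add: of_nat_eq_0_iff_char_dvd)
  then obtain g :: "'a alg_closure" where "primitive_root_of_unity (q\<^sup>2 - 1) g"
    using ex_primitive_root_of_unity by blast
  then show ?thesis using assms cayley_exponents.intro by blast
qed

theorem theorem1:
  fixes p :: nat
  assumes "prime p" and "p \<ge> 5" and "CARD('a::{field,finite}) = p"
  shows "Q_plus p \<inter> Q_minus p = {}
    \<and> int p + eps p = 2 * (\<Prod>q\<in>Q_plus p. int q ^ expo p q)
    \<and> int p - eps p = 2 ^ (expo p 2 - 1) * (\<Prod>q\<in>Q_minus p. int q ^ expo p q)
    \<and> (\<exists>\<Phi> :: nat \<Rightarrow> ('a \<times> 'a \<times> 'a) set.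
         bij_betw \<Phi> (D_set p) cayley_orbits
         \<and> (\<forall>t\<in>D_set p. t \<noteq> p\<^sup>2 - 1 \<and> t \<noteq> (p\<^sup>2 - 1) div 2
               \<longrightarrow> real (card (\<Phi> t)) = size_expr p t)
         \<and> (\<forall>t\<in>{p\<^sup>2 - 1, (p\<^sup>2 - 1) div 2}. real (card (\<Phi> t)) = 2 * size_expr p t))
    \<and> int (card (cayley_orbits :: ('a \<times> 'a \<times> 'a) set set)) =
        int (expo p 2) * (\<Prod>q\<in>Q_minus p. int (expo p q) + 1)
        + 2 * (\<Prod>q\<in>Q_plus p. int (expo p q) + 1) - 2"
proof -
  have odd_ge_3: "odd p" "p \<ge> 3" using assms(1,2) prime_odd_nat by auto
  obtain g :: "'a alg_closure" where "cayley_exponents p g"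
    using ex_cayley_exponents[OF assms(3)] by blast
  then interpret cayley_exponents p g .
  have "card (cayley_orbits :: ('a \<times> 'a \<times> 'a) set set) = card (D_set p)"
    using bij_betw_same_card[OF bij_betw_exponent_class] by simp
  then have "int (card (cayley_orbits :: ('a \<times> 'a \<times> 'a) set set)) =
        int (expo p 2) * (\<Prod>q\<in>Q_minus p. int (expo p q) + 1)
        + 2 * (\<Prod>q\<in>Q_plus p. int (expo p q) + 1) - 2"
    using card_D_set[OF odd_ge_3] by simp
  moreover have "bij_betw exponent_class (D_set p) cayley_orbits
     \<and> (\<forall>t\<in>D_set p. t \<noteq> p\<^sup>2 - 1 \<and> t \<noteq> (p\<^sup>2 - 1) div 2
           \<longrightarrow> real (card (exponent_class t)) = size_expr p t)
     \<and> (\<forall>t\<in>{p\<^sup>2 - 1, (p\<^sup>2 - 1) div 2}. real (card (exponent_class t)) = 2 * size_expr p t)"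
    using bij_betw_exponent_class card_exponent_class odd_ge_3(1)
      square_minus_1_in_D_set[OF odd_ge_3(1)]
    by (auto simp: N_def)
  ultimately show ?thesis
    using Q_plus_Int_Q_minus[OF odd_ge_3] plus_eps_eq_prod[OF odd_ge_3]
      minus_eps_eq_prod[OF odd_ge_3] by blast
qed

end
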